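(* Let $(\Omega,\mathcal{F},\mathbb{P},\sigma)$ be an ergodic probability measure-preserving dynamical system, and let $F\in\widetilde{\mathcal{E}}(\Omega)$ be an integrable random lift of the generator $f$ of a random circle endomorphism over $(\Omega,\mathcal{F},\mathbb{P},\sigma)$, with lower and upper maps $F_L,F_U$. If the random rotation set $\mathrm{Rot}(F)=[\rho(F_L),\rho(F_U)]$ is non-degenerate, i.e. $\rho(F_U)>\rho(F_L)$, then $f$ has positive random topological entropy: $h^{(\mathrm{r})}_{\mathrm{top}}(f)>0$.
   Context: $\mathbb{S}^1=\mathbb{R}/\mathbb{Z}$ with standard metric $d_{\mathbb{S}^1}$, $\pi:\mathbb{R}\to\mathbb{S}^1$ is the projection. $\mathrm{End}_1(\mathbb{S}^1)$ is the set of continuous degree-one circle maps; $\mathrm{End}_1(\mathbb{R})$ is the set of continuous $F:\mathbb{R}\to\mathbb{R}$ with $F(x+1)=F(x)+1$ for all $x$; $\mathrm{Mon}_1(\mathbb{R})$ is the set of non-decreasing elements of $\mathrm{End}_1(\mathbb{R})$. A random circle endomorphism over $(\Omega,\mathcal{F},\mathbb{P},\sigma)$ is given by a generator, i.e. a measurable map $f:\Omega\to\mathrm{End}_1(\mathbb{S}^1)$, $\omega\mapsto f_\omega$, through the cocycle $f^{(0)}_\omega=\mathrm{Id}$, $f^{(n)}_\omega=f_{\sigma^{n-1}\omega}\circ\cdots\circ f_\omega$. A random lift of $f$ is a measurable map $F:\Omega\to\mathrm{End}_1(\mathbb{R})$ with $\pi\circ F_\omega=f_\omega\circ\pi$ for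 every $\omega$; its cocycle is $F^{(n)}_\omega=F_{\sigma^{n-1}\omega}\circ\cdots\circ F_\omega$. $\widetilde{\mathcal{E}}(\Omega)$ is the set of measurable $F:\Omega\to\mathrm{End}_1(\mathbb{R})$ with $\int_\Omega\|F_\omega-\mathrm{Id}\|\,\mathrm{d}\mathbb{P}(\omega)<\infty$, where $\|\cdot\|$ is the sup norm; $\widetilde{\mathcal{M}}(\Omega)$ is the subset of those $F$ with values in $\mathrm{Mon}_1(\mathbb{R})$. Lower and upper maps: $F_{\omega,L}(x)=\inf_{y\ge x}F_\omega(y)$, $F_{\omega,U}(x)=\sup_{y\le x}F_\omega(y)$; both $F_L,F_U$ belong to $\widetilde{\mathcal{M}}(\Omega)$. For $G\in\widetilde{\mathcal{M}}(\Omega)$, by a known result (Li–Lu) there is an integrable function $\rho_G$ such that for any $x\in\mathbb{R}$, $\lim_{n\to\infty}(G^{(n)}_\omega(x)-x)/n=\rho_G(\omega)$ for a.e. $\omega$; $\rho(G)=\int_\Omega\rho_G\,\mathrm{d}\mathbb{P}$ (for ergodic $\sigma$, $\rho_G=\rho(G)$ a.e.). The random rotation set is $\mathrm{Rot}_F(\omega)=\overline{\{\limsup_{n\to\infty}(F^{(n)}_\omega(x)-x)/n:x\in\mathbb{R}\}}$, which over an ergodic base is almost surely equal to the interval $\mathrm{Rot}(F)=[\rho(F_L),\rho(F_U)]$. Entropy: $d^f_{\omega,n}(x,y)=\max_{0\le k<n}d_{\mathbb{S}^1}(f^{(k)}_\omega(x),f^{(k)}_\omega(y))$; $E\subset\mathbb{S}^1$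 is $(n,\varepsilon,\omega)$-separated if $d^f_{\omega,n}(x,y)\ge\varepsilon$ for all distinct $x,y\in E$; $s(n,\varepsilon,\omega,f)$ is the maximal cardinality of such a set; $h_\varepsilon(f,\omega)=\limsup_{n\to\infty}\frac1n\log s(n,\varepsilon,\omega,f)$. This is measurable and $\sigma$-invariant in $\omega$, hence a.s. constant when $\sigma$ is ergodic, and $h^{(\mathrm{r})}_{\mathrm{top}}(f)$ is the almost sure value of $\lim_{\varepsilon\to0}h_\varepsilon(f,\omega)$. *)

theory Defs
  imports "HOL-Probability.Probability"
begin

section \<open>The circle\<close>

lemma equivp_circle: "equivp (\<lambda>x y :: real. x - y \<in> \<int>)"
proof (rule equivpI)
  show "reflp (\<lambda>x y :: real. x - y \<in> \<int>)" by (auto intro: reflpI)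
  show "symp (\<lambda>x y :: real. x - y \<in> \<int>)"
    by (rule sympI) (metis Ints_minus minus_diff_eq)
  show "transp (\<lambda>x y :: real. x - y \<in> \<int>)"
  proof (rule transpI)
    fix x y z :: real assume "x - y \<in> \<int>" "y - z \<in> \<int>"
    then have "(x - y) + (y - z) \<in> \<int>" by (rule Ints_add)
    then show "x - z \<in> \<int>" by simp
  qed
qed

quotient_type circle = real / "\<lambda>x y. x - y \<in> \<int>"
  by (rule equivp_circle)

lift_definition proj :: "real \<Rightarrow> circle" is "\<lambda>x. x" .

lemma infdist_Ints_add:
  fixes x k :: real
  assumes "k \<in> \<int>"
  shows "infdist (x + k) \<int> = infdist x \<int>"
proof -
  have le: "infdist (x + k) \<int> \<le> infdist x \<int>" if "k \<in> \<int>" for x k :: real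
  proof -
    have "infdist (x + k) \<int> \<le> dist x a" if "a \<in> \<int>" for a
      using infdist_le[OF Ints_add[OF that \<open>k \<in> \<int>\<close>], of "x + k"] by simp
    then have "infdist (x + k) \<int> \<le> (INF a\<in>\<int>. dist x a)"
      by (intro cINF_greatest) (auto intro: Ints_0)
    then show ?thesis by (metis Ints_0 empty_iff infdist_notempty)
  qed
  have "infdist ((x + k) + (- k)) \<int> \<le> infdist (x + k) \<int>"
    by (rule le) (use assms in auto)
  with le[OF assms, of x] show ?thesis by simp
qed

instantiation circle :: metric_space
begin

lift_definition dist_circle :: "circle \<Rightarrow> circle \<Rightarrow> real" is "\<lambda>x y. infdist (x - y) \<int>"
proof -
  fix x x' y y' :: real
  assume "x - x' \<in> \<int>" "y - y' \<in> \<int>"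
  then have "(x - x') - (y - y') \<in> \<int>" by (rule Ints_diff)
  from infdist_Ints_add[OF this, of "x' - y'"]
  show "infdist (x - y) \<int> = infdist (x' - y') \<int>" by (simp add: algebra_simps)
qed

definition uniformity_circle :: "(circle \<times> circle) filter" where
  "uniformity_circle = (INF e\<in>{0<..}. principal {(x, y). dist x y < e})"

definition open_circle :: "circle set \<Rightarrow> bool" where
  "open_circle U = (\<forall>x\<in>U. eventually (\<lambda>(x', y). x' = x \<longrightarrow> y \<in> U) uniformity)"

instance
proof
  show "dist x y = 0 \<longleftrightarrow> x = y" for x y :: circle
  proof transfer
    fix x y :: real
    have "(x - y \<in> \<int>) = (infdist (x - y) \<int> = 0)"
      by (rule in_closed_iff_infdist_zero) (auto intro: Ints_0)
    then show "(infdist (x - y) \<int> = 0) = (x - y \<in> \<int>)" by simp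
  qed
  show "dist x y \<le> dist x z + dist y z" for x y z :: circle
  proof transfer
    fix x y z :: real
    have ne: "(\<int> :: real set) \<noteq> {}" by (auto intro: Ints_0)
    have "infdist (x - y) \<int> - infdist (x - z) \<int> \<le> dist (y - z) b" if "b \<in> \<int>" for b
    proof -
      have "infdist (x - y) \<int> = infdist (x - y + b) \<int>"
        using infdist_Ints_add[OF that] by simp
      also have "\<dots> \<le> infdist (x - z) \<int> + dist (x - y + b) (x - z)"
        by (rule infdist_triangle)
      also have "dist (x - y + b) (x - z) = dist (y - z) b"
        by (simp add: dist_real_def algebra_simps)
      finally show ?thesis by simp
    qed
    then have "infdist (x - y) \<int> - infdist (x - z) \<int> \<le> (INF b\<in>\<int>. dist (y - z) b)"
      using ne by (intro cINF_greatest) auto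
    then show "infdist (x - y) \<int> \<le> infdist (x - z) \<int> + infdist (y - z) \<int>"
      using infdist_notempty[OF ne] by simp
  qed
qed (fact uniformity_circle_def open_circle_def)+

end

section \<open>Degree-one maps\<close>

definition End1_real :: "(real \<Rightarrow> real) set" where
  "End1_real = {F. continuous_on UNIV F \<and> (\<forall>x. F (x + 1) = F x + 1)}"

text \<open>A continuous circle map has degree one iff its lifts commute with the unit translation.\<close>

definition End1_circle :: "(circle \<Rightarrow> circle) set" where
  "End1_circle = {f. continuous_on UNIV f \<and> (\<exists>F\<in>End1_real. proj \<circ> F = f \<circ> proj)}"

definition sup_dist :: "('a \<Rightarrow> 'b::metric_space) \<Rightarrow> ('a \<Rightarrow> 'b) \<Rightarrow> real" where
  "sup_dist f g = (SUP x. dist (f x) (g x))"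

text \<open>On degree-one maps the supremum in \<^const>\<open>sup_dist\<close> is that of a bounded set.\<close>

lemma bdd_above_dist_End1_real:
  assumes "F \<in> End1_real" "G \<in> End1_real"
  shows "bdd_above (range (\<lambda>x. dist (F x) (G x)))"
proof -
  define d where "d x = dist (F x) (G x)" for x
  have shift: "d (x + 1) = d x" for x
    using assms by (simp add: d_def End1_real_def dist_real_def)
  have nat_shift: "d (x + of_nat n) = d x" for x n
  proof (induction n)
    case (Suc n)
    then show ?case using shift[of "x + of_nat n"] by (simp add: algebra_simps)
  qed simp
  have int_shift: "d (x + of_int k) = d x" for x k
  proof (cases k rule: int_cases2)
    case (nonneg n)
    then show ?thesis using nat_shift[of x n] by simp
  next
    case (nonpos n)
    then show ?thesis using nat_shift[of "x - of_nat n" n] by simp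
  qed
  have "continuous_on {0..1} d"
    unfolding d_def using assms
    by (intro continuous_intros) (auto simp: End1_real_def intro: continuous_on_subset)
  then have "bdd_above (d ` {0..1})"
    by (intro bounded_imp_bdd_above compact_imp_bounded compact_continuous_image) auto
  moreover have "range d \<subseteq> d ` {0..1}"
  proof
    fix y assume "y \<in> range d"
    then obtain x where "y = d x" by auto
    then have "y = d (frac x)"
      using int_shift[of "frac x" "\<lfloor>x\<rfloor>"] by (simp add: frac_def)
    then show "y \<in> d ` {0..1}"
      using frac_ge_0[of x] frac_lt_1[of x] by (auto intro!: imageI)
  qed
  ultimately show ?thesis
    unfolding d_def by (rule bdd_above_mono)
qed

lemma bdd_above_dist_circle:
  "bdd_above (range (\<lambda>x. dist (f x) (g x :: circle)))"
proof (rule bdd_aboveI2)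
  fix x
  have "infdist (a - b) \<int> \<le> 1" for a b :: real
    using infdist_le[of "of_int \<lfloor>a - b\<rfloor>" \<int> "a - b"] frac_lt_1[of "a - b"]
    by (simp add: dist_real_def frac_def)
  then have "dist p q \<le> 1" for p q :: circle
    by transfer simp
  then show "dist (f x) (g x) \<le> 1" by simp
qed

text \<open>The Borel \<open>\<sigma>\<close>-algebra of the uniform topology on \<open>S\<close>.\<close>

definition uniform_borel :: "('a \<Rightarrow> 'b::metric_space) set \<Rightarrow> ('a \<Rightarrow> 'b) measure" where
  "uniform_borel S =
     sigma S {U. U \<subseteq> S \<and> (\<forall>f\<in>U. \<exists>e>0. \<forall>g\<in>S. sup_dist f g < e \<longrightarrow> g \<in> U)}"

section \<open>Random dynamics\<close>

definition ergodic_system :: "'w measure \<Rightarrow> ('w \<Rightarrow> 'w) \<Rightarrow> bool" where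
  "ergodic_system M \<sigma> \<longleftrightarrow>
     prob_space M \<and> \<sigma> \<in> measurable M M \<and> distr M M \<sigma> = M \<and>
     (\<forall>A\<in>sets M. \<sigma> -` A \<inter> space M = A \<longrightarrow> measure M A = 0 \<or> measure M A = 1)"

definition random_circle_endomorphism :: "'w measure \<Rightarrow> ('w \<Rightarrow> circle \<Rightarrow> circle) \<Rightarrow> bool" where
  "random_circle_endomorphism M f \<longleftrightarrow> f \<in> measurable M (uniform_borel End1_circle)"

fun cocycle :: "('w \<Rightarrow> 'w) \<Rightarrow> ('w \<Rightarrow> 'a \<Rightarrow> 'a) \<Rightarrow> nat \<Rightarrow> 'w \<Rightarrow> 'a \<Rightarrow> 'a" where
  "cocycle \<sigma> f 0 \<omega> = id"
| "cocycle \<sigma> f (Suc n) \<omega> = f ((\<sigma> ^^ n) \<omega>) \<circ> cocycle \<sigma> f n \<omega>"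

definition random_lift ::
  "'w measure \<Rightarrow> ('w \<Rightarrow> circle \<Rightarrow> circle) \<Rightarrow> ('w \<Rightarrow> real \<Rightarrow> real) \<Rightarrow> bool" where
  "random_lift M f F \<longleftrightarrow>
     F \<in> measurable M (uniform_borel End1_real) \<and>
     (\<forall>\<omega>\<in>space M. proj \<circ> F \<omega> = f \<omega> \<circ> proj)"

definition integrable_lifts :: "'w measure \<Rightarrow> ('w \<Rightarrow> real \<Rightarrow> real) set" where
  "integrable_lifts M =
     {F. F \<in> measurable M (uniform_borel End1_real) \<and> integrable M (\<lambda>\<omega>. sup_dist (F \<omega>) id)}"

definition lower_map :: "('w \<Rightarrow> real \<Rightarrow> real) \<Rightarrow> 'w \<Rightarrow> real \<Rightarrow> real" where
  "lower_map F \<omega> x = (INF y\<in>{x..}. F \<omega> y)"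

definition upper_map :: "('w \<Rightarrow> real \<Rightarrow> real) \<Rightarrow> 'w \<Rightarrow> real \<Rightarrow> real" where
  "upper_map F \<omega> x = (SUP y\<in>{..x}. F \<omega> y)"

text \<open>For integrable \<open>G\<close> with non-decreasing degree-one values, a function as chosen here exists by
  a theorem of Li and Lu. It is unique up to null sets, so its integral does not depend on the
  choice.\<close>

definition rotation_function ::
  "'w measure \<Rightarrow> ('w \<Rightarrow> 'w) \<Rightarrow> ('w \<Rightarrow> real \<Rightarrow> real) \<Rightarrow> 'w \<Rightarrow> real" where
  "rotation_function M \<sigma> G =
     (SOME r. integrable M r \<and>
        (\<forall>x. AE \<omega> in M. (\<lambda>n. (cocycle \<sigma> G n \<omega> x - x) / real n) \<longlonglongrightarrow> r \<omega>))"

definition rotation_number ::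
  "'w measure \<Rightarrow> ('w \<Rightarrow> 'w) \<Rightarrow> ('w \<Rightarrow> real \<Rightarrow> real) \<Rightarrow> real" where
  "rotation_number M \<sigma> G = (LINT \<omega>|M. rotation_function M \<sigma> G \<omega>)"

section \<open>Random topological entropy\<close>

text \<open>Only the values for \<open>n \<ge> 1\<close> matter: at \<open>n = 0\<close> the maximum is over the empty set.\<close>

definition bowen_dist ::
  "('w \<Rightarrow> 'w) \<Rightarrow> ('w \<Rightarrow> circle \<Rightarrow> circle) \<Rightarrow> 'w \<Rightarrow> nat \<Rightarrow> circle \<Rightarrow> circle \<Rightarrow> real" where
  "bowen_dist \<sigma> f \<omega> n x y =
     Max ((\<lambda>k. dist (cocycle \<sigma> f k \<omega> x) (cocycle \<sigma> f k \<omega> y)) ` {..<n})"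

definition separated ::
  "('w \<Rightarrow> 'w) \<Rightarrow> ('w \<Rightarrow> circle \<Rightarrow> circle) \<Rightarrow> nat \<Rightarrow> real \<Rightarrow> 'w \<Rightarrow> circle set \<Rightarrow> bool" where
  "separated \<sigma> f n \<epsilon> \<omega> E \<longleftrightarrow> (\<forall>x\<in>E. \<forall>y\<in>E. x \<noteq> y \<longrightarrow> \<epsilon> \<le> bowen_dist \<sigma> f \<omega> n x y)"

text \<open>For \<open>n \<ge> 1\<close>, \<open>\<epsilon> > 0\<close> and continuous \<open>f\<close>, separated sets are finite of bounded cardinality, by
  compactness of the circle.\<close>

definition max_separated ::
  "('w \<Rightarrow> 'w) \<Rightarrow> ('w \<Rightarrow> circle \<Rightarrow> circle) \<Rightarrow> nat \<Rightarrow> real \<Rightarrow> 'w \<Rightarrow> nat" where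
  "max_separated \<sigma> f n \<epsilon> \<omega> = Max {card E | E. finite E \<and> separated \<sigma> f n \<epsilon> \<omega> E}"

definition entropy_at_scale ::
  "('w \<Rightarrow> 'w) \<Rightarrow> ('w \<Rightarrow> circle \<Rightarrow> circle) \<Rightarrow> real \<Rightarrow> 'w \<Rightarrow> ereal" where
  "entropy_at_scale \<sigma> f \<epsilon> \<omega> =
     limsup (\<lambda>n. ereal (ln (real (max_separated \<sigma> f n \<epsilon> \<omega>)) / real n))"

text \<open>The almost sure value (possibly infinite) of the limit as \<open>\<epsilon>\<close> tends to \<open>0\<close>; it exists and is
  unique over an ergodic base.\<close>

definition random_top_entropy ::
  "'w measure \<Rightarrow> ('w \<Rightarrow> 'w) \<Rightarrow> ('w \<Rightarrow> circle \<Rightarrow> circle) \<Rightarrow> ereal" where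
  "random_top_entropy M \<sigma> f =
     (THE h. AE \<omega> in M. ((\<lambda>\<epsilon>. entropy_at_scale \<sigma> f \<epsilon> \<omega>) \<longlongrightarrow> h) (at_right 0))"

end

(*
  The upper envelope (running supremum) of degree-one maps is multiplicative under composition, so
  the cocycles of F_L and F_U are the envelopes of the cocycle of F. If rho(F_L) < rho(F_U), then for
  some N and for base points in a set A of positive measure, F^(N) stretches every interval of length
  two over one of length at least six. Each visit to A thus doubles the number of lifted orbits which
  get apart by distance one, and by Birkhoff's theorem these visits have positive frequency.

  Lifted orbits that are apart can still be close on the circle. But while two circle orbits remain
  e-close, their lifts differ by an integer up to e, and this integer can jump only at times when
  F_omega moves some e-close points apart by more than 1/2, by an amount controlled by the norm of
  F_omega - Id. The exponential growth rate of the number of possible jump sequences is at most the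
  integral of the logarithm of that norm over the bad times, which tends to 0 with e by
  integrability. So for small e a positive exponential rate of e-separated circle orbits remains.
*)
theory Submission
  imports Defs "HOL-Real_Asymp.Real_Asymp"
begin

section \<open>Birkhoff's ergodic theorem\<close>

text \<open>The quantitative outcome is a lower bound for the entropy at scale \<open>e\<close>:
  \<open>prob A / N * ln 2\<close> minus the integral of \<open>ln (jump_count e)\<close>. The
  factor 1/N is there because two doublings have to be at least N steps apart. N and A are found on
  the line, without reference to \<open>e\<close>, so the scale can be chosen last. The obstacle is
  that no modulus of continuity is uniform in \<omega>: no single scale suits all fibres, so the
  loss in passing from the line to the circle is averaged along the orbit. Two definitions shape the
  rest. \<open>rotation_function\<close> is a choice, so the existence of the Li-Lu limit has to be
  proved before anything can be said about it. \<open>random_top_entropy\<close> is a definite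
  description, so the limit over the scales must be shown to be measurable and almost surely
  constant; for constancy an inequality in one direction along \<sigma> suffices.\<close>

locale ergodic_base = prob_space M for M :: "'w measure" +
  fixes \<sigma> :: "'w \<Rightarrow> 'w"
  assumes base_measurable [measurable]: "\<sigma> \<in> measurable M M"
    and distr_base: "distr M M \<sigma> = M"
    and ergodic: "\<And>A. A \<in> sets M \<Longrightarrow> \<sigma> -` A \<inter> space M = A \<Longrightarrow> prob A = 0 \<or> prob A = 1"
begin

lemma base_space: "\<omega> \<in> space M \<Longrightarrow> \<sigma> \<omega> \<in> space M"
  using base_measurable by (rule measurable_space)

lemma base_iterate_measurable [measurable]: "\<sigma> ^^ n \<in> measurable M M"
  by (induction n) auto

lemma base_iterate_space: "\<omega> \<in> space M \<Longrightarrow> (\<sigma> ^^ n) \<omega> \<in> space M"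
  by (rule measurable_space[OF base_iterate_measurable])

lemma integral_base:
  fixes g :: "'w \<Rightarrow> real"
  assumes "g \<in> borel_measurable M"
  shows "(\<integral>\<omega>. g (\<sigma> \<omega>) \<partial>M) = (\<integral>\<omega>. g \<omega> \<partial>M)"
  using integral_distr[OF base_measurable assms] by (simp add: distr_base)

lemma integrable_base:
  fixes g :: "'w \<Rightarrow> real"
  assumes "integrable M g"
  shows "integrable M (\<lambda>\<omega>. g (\<sigma> \<omega>))"
  using integrable_distr[OF base_measurable, of g] assms by (simp add: distr_base)

lemma integrable_base_iterate:
  fixes g :: "'w \<Rightarrow> real"
  assumes "integrable M g"
  shows "integrable M (\<lambda>\<omega>. g ((\<sigma> ^^ n) \<omega>))"
  using assms
proof (induction n arbitrary: g)
  case (Suc n)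
  then show ?case using integrable_base[OF Suc.prems] by simp
qed simp

lemma prob_base:
  assumes "A \<in> sets M"
  shows "prob (\<sigma> -` A \<inter> space M) = prob A"
  using measure_distr[OF base_measurable assms] by (simp add: distr_base)

text \<open>The iterated preimages of \<open>A\<close> decrease and all have the probability of
  \<open>A\<close>. Their intersection is strictly invariant with the same probability, so
  ergodicity applies to it.\<close>

lemma prob_sub_invariant:
  assumes A: "A \<in> sets M" and sub: "\<sigma> -` A \<inter> space M \<subseteq> A"
  shows "prob A = 0 \<or> prob A = 1"
proof -
  define B where "B n = (\<sigma> ^^ n) -` A \<inter> space M" for n
  have B_sets: "B n \<in> sets M" for n
    unfolding B_def using A by measurable
  have B_Suc: "B (Suc n) = \<sigma> -` B n \<inter> space M" for n
    by (auto simp: B_def base_space funpow_swap1)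
  have B_0: "B 0 = A"
    using sets.sets_into_space[OF A] by (auto simp: B_def)
  have dec: "B (Suc n) \<subseteq> B n" for n
  proof (induction n)
    case 0
    then show ?case using sub by (simp add: B_Suc B_0)
  next
    case (Suc n)
    then show ?case by (subst (1 2) B_Suc) auto
  qed
  have prob_B: "prob (B n) = prob A" for n
    by (induction n) (simp_all add: B_0 B_Suc prob_base B_sets)
  have "(\<lambda>n. prob (B n)) \<longlonglongrightarrow> prob (\<Inter>n. B n)"
    using B_sets dec by (intro finite_Lim_measure_decseq) (auto intro: decseq_SucI)
  then have eq: "prob (\<Inter>n. B n) = prob A"
    by (simp add: prob_B LIMSEQ_const_iff)
  have "\<sigma> -` (\<Inter>n. B n) \<inter> space M = (\<Inter>n. B (Suc n))"
    by (auto simp: B_Suc)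
  also have "\<dots> = (\<Inter>n. B n)"
    using dec by fast
  finally have "prob (\<Inter>n. B n) = 0 \<or> prob (\<Inter>n. B n) = 1"
    using B_sets by (intro ergodic) auto
  then show ?thesis by (simp add: eq)
qed

text \<open>The superlevel sets of \<open>H\<close> at rational levels are sub-invariant, hence of
  probability 0 or 1, and these countably many sets determine the value of \<open>H\<close>. The
  lemma serves for the entropy, where one inequality along \<sigma> is easy and the value may be
  infinite.\<close>

lemma AE_const_if_sub_invariant:
  fixes H :: "'w \<Rightarrow> ereal"
  assumes [measurable]: "H \<in> borel_measurable M"
    and sub: "\<And>\<omega>. \<omega> \<in> space M \<Longrightarrow> H (\<sigma> \<omega>) \<le> H \<omega>"
  shows "\<exists>c. AE \<omega> in M. H \<omega> = c"
proof -
  define A where "A q = {\<omega> \<in> space M. ereal (real_of_rat q) < H \<omega>}" for q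
  have A [measurable]: "A q \<in> sets M" for q
    unfolding A_def by measurable
  have prob_A: "prob (A q) = 0 \<or> prob (A q) = 1" for q
    using sub by (intro prob_sub_invariant A) (auto simp: A_def intro: less_le_trans)
  have "AE \<omega> in M. \<omega> \<in> A q \<longleftrightarrow> prob (A q) = 1" for q
    using prob_A[of q]
  proof
    assume 0: "prob (A q) = 0"
    then have "AE \<omega> in M. \<omega> \<notin> A q"
      using prob_eq_0[OF A] by simp
    then show ?thesis using 0 by simp
  next
    assume 1: "prob (A q) = 1"
    then show ?thesis using prob_eq_1[OF A] by simp
  qed
  then have all: "AE \<omega> in M. \<forall>q. \<omega> \<in> A q \<longleftrightarrow> prob (A q) = 1"
    by (subst AE_all_countable) auto
  have "\<exists>\<omega>\<in>space M. \<forall>q. \<omega> \<in> A q \<longleftrightarrow> prob (A q) = 1"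
  proof (rule ccontr)
    assume "\<not> ?thesis"
    then have "AE \<omega> in M. False"
      by - (rule AE_mp[OF all AE_I2], blast)
    then show False by simp
  qed
  then obtain \<omega>0 where \<omega>0: "\<omega>0 \<in> space M" "\<And>q. \<omega>0 \<in> A q \<longleftrightarrow> prob (A q) = 1"
    by blast
  have not_less: "\<not> H \<omega> < H \<omega>'"
    if "\<omega> \<in> space M" "\<omega>' \<in> space M" "\<And>q. \<omega> \<in> A q \<longleftrightarrow> \<omega>' \<in> A q" for \<omega> \<omega>'
  proof
    assume "H \<omega> < H \<omega>'"
    then obtain r where r: "H \<omega> < ereal r" "ereal r < H \<omega>'"
      using ereal_dense2 by blast
    then obtain r' where r': "ereal r < ereal r'" "ereal r' < H \<omega>'"
      using ereal_dense2 by blast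
    then obtain q where q: "r < real_of_rat q" "real_of_rat q < r'"
      using of_rat_dense[of r r'] by auto
    then have "ereal (real_of_rat q) < H \<omega>'" "\<not> ereal (real_of_rat q) < H \<omega>"
      using r r' by (meson ereal_less(2) less_ereal.simps(1) less_trans not_less_iff_gr_or_eq)+
    then have "\<omega>' \<in> A q" "\<omega> \<notin> A q"
      using that by (auto simp: A_def)
    then show False using that by blast
  qed
  have "AE \<omega> in M. H \<omega> = H \<omega>0"
    using all AE_space
  proof eventually_elim
    case (elim \<omega>)
    then show ?case
      using not_less[of \<omega> \<omega>0] not_less[of \<omega>0 \<omega>] \<omega>0 by (meson linorder_less_linear)
  qed
  then show ?thesis by blast
qed

lemma AE_bdd_above_birkhoff_sums:
  fixes g :: "'w \<Rightarrow> real"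
  assumes g: "integrable M g" and neg: "(\<integral>\<omega>. g \<omega> \<partial>M) < 0"
  shows "AE \<omega> in M. bdd_above (range (\<lambda>n. \<Sum>k<n. g ((\<sigma> ^^ k) \<omega>)))"
proof -
  define S where "S n \<omega> = (\<Sum>k<n. g ((\<sigma> ^^ k) \<omega>))" for n \<omega>
  \<comment> \<open>\<open>K n\<close> is the maximum of \<open>S 0, \<dots>, S n\<close>; the argument is Garsia's, restricted to the invariant
    set \<open>A\<close> where the sums are unbounded.\<close>
  define K where "K = rec_nat (\<lambda>_. 0 :: real) (\<lambda>_ u \<omega>. max 0 (g \<omega> + u (\<sigma> \<omega>)))"
  have [measurable]: "g \<in> borel_measurable M"
    using g by auto
  have [measurable]: "S n \<in> borel_measurable M" for n
    unfolding S_def by measurable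
  have S_Suc: "S (Suc n) \<omega> = g \<omega> + S n (\<sigma> \<omega>)" for n \<omega>
    unfolding S_def by (subst sum.lessThan_Suc_shift) (simp add: funpow_swap1)
  have K_0: "K 0 \<omega> = 0" and K_Suc: "K (Suc n) \<omega> = max 0 (g \<omega> + K n (\<sigma> \<omega>))" for n \<omega>
    by (simp_all add: K_def)
  have K_int: "integrable M (K n)" for n
  proof (induction n)
    case 0
    then show ?case by (simp add: K_def)
  next
    case (Suc n)
    have "integrable M (\<lambda>\<omega>. max 0 (g \<omega> + K n (\<sigma> \<omega>)))"
      using g integrable_base[OF Suc] by (intro integrable_max) auto
    then show ?case by (simp add: K_def)
  qed
  have [measurable]: "K n \<in> borel_measurable M" for n
    using K_int by blast
  have K_nonneg: "0 \<le> K n \<omega>" for n \<omega>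
    by (cases n) (auto simp: K_0 K_Suc)
  have K_mono: "K n \<omega> \<le> K (Suc n) \<omega>" for n \<omega>
  proof (induction n arbitrary: \<omega>)
    case (Suc n)
    show ?case using Suc[of "\<sigma> \<omega>"] by (simp add: K_Suc[of "Suc n"] K_Suc[of n])
  qed (simp add: K_0 K_nonneg)
  have S_le_K: "S n \<omega> \<le> K n \<omega>" for n \<omega>
    by (induction n arbitrary: \<omega>) (auto simp: S_def[of 0] K_0 S_Suc K_Suc intro: le_max_iff_disj[THEN iffD2])
  define A where "A = {\<omega> \<in> space M. \<forall>B::nat. \<exists>n. real B < S n \<omega>}"
  have A_sets [measurable]: "A \<in> sets M"
    unfolding A_def by measurable
  \<comment> \<open>The sums \<open>S (Suc n) \<omega>\<close> and
    \<open>S n (\<sigma> \<omega>)\<close> differ by the one term \<open>g \<omega>\<close>, so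
    being unbounded above is an invariant property.\<close>
  have shift: "(\<forall>B::nat. \<exists>n. real B < S n (\<sigma> \<omega>)) \<longleftrightarrow> (\<forall>B::nat. \<exists>n. real B < S n \<omega>)" for \<omega>
  proof (intro iffI allI)
    fix B :: nat
    assume *: "\<forall>B::nat. \<exists>n. real B < S n (\<sigma> \<omega>)"
    obtain B' :: nat where "real B + \<bar>g \<omega>\<bar> < real B'" using reals_Archimedean2 by blast
    moreover obtain n where "real B' < S n (\<sigma> \<omega>)" using * by blast
    ultimately have "real B < S (Suc n) \<omega>" by (simp add: S_Suc)
    then show "\<exists>n. real B < S n \<omega>" by blast
  next
    fix B :: nat
    assume *: "\<forall>B::nat. \<exists>n. real B < S n \<omega>"
    obtain B' :: nat where B': "real B + \<bar>g \<omega>\<bar> < real B'" using reals_Archimedean2 by blast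
    obtain n where n: "real B' < S n \<omega>" using * by blast
    with B' have "n \<noteq> 0" by (auto simp: S_def intro!: gr0I)
    then obtain n' where "n = Suc n'" by (cases n) auto
    with n B' have "real B < S n' (\<sigma> \<omega>)" by (simp add: S_Suc)
    then show "\<exists>n. real B < S n (\<sigma> \<omega>)" by blast
  qed
  have A_inv: "\<sigma> \<omega> \<in> A \<longleftrightarrow> \<omega> \<in> A" if "\<omega> \<in> space M" for \<omega>
    using that base_space shift by (auto simp: A_def)
  \<comment> \<open>As \<open>K (Suc n) - K n \<circ> \<sigma>\<close>, this has non-negative
    integral over the invariant set \<open>A\<close>, because \<open>K\<close> increases with n. On
    \<open>A\<close> it equals \<open>g\<close> as soon as \<open>K n (\<sigma> \<omega>)\<close>
    exceeds \<open>\<bar>g \<omega>\<bar>\<close>.\<close>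
  define D where "D n \<omega> = max (- K n (\<sigma> \<omega>)) (g \<omega>)" for n \<omega>
  have D_eq: "D n \<omega> = K (Suc n) \<omega> - K n (\<sigma> \<omega>)" for n \<omega>
    by (auto simp: D_def K_Suc max_def)
  have [measurable]: "D n \<in> borel_measurable M" for n
    unfolding D_def by measurable
  have D_lim: "(\<lambda>n. D n \<omega>) \<longlonglongrightarrow> g \<omega>" if "\<omega> \<in> A" for \<omega>
  proof (rule tendsto_eventually)
    obtain B :: nat where B: "\<bar>g \<omega>\<bar> < real B" using reals_Archimedean2 by blast
    have "\<forall>B::nat. \<exists>n. real B < S n (\<sigma> \<omega>)"
      using that shift[of \<omega>] by (simp add: A_def)
    then obtain n where n: "real B < S n (\<sigma> \<omega>)"
      by blast
    have "D m \<omega> = g \<omega>" if "n \<le> m" for m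
    proof -
      have "K n (\<sigma> \<omega>) \<le> K m (\<sigma> \<omega>)"
        using that by (rule lift_Suc_mono_le[of "\<lambda>n. K n (\<sigma> \<omega>)", OF K_mono])
      then show ?thesis using S_le_K[of n "\<sigma> \<omega>"] n B by (simp add: D_def)
    qed
    then show "\<forall>\<^sub>F n in sequentially. D n \<omega> = g \<omega>"
      by (auto simp: eventually_sequentially)
  qed
  have lim: "(\<lambda>n. \<integral>\<omega>. indicator A \<omega> * D n \<omega> \<partial>M) \<longlonglongrightarrow> (\<integral>\<omega>. indicator A \<omega> * g \<omega> \<partial>M)"
  proof (rule integral_dominated_convergence[where w = "\<lambda>\<omega>. \<bar>g \<omega>\<bar>"])
    show "AE \<omega> in M. (\<lambda>n. indicator A \<omega> * D n \<omega>) \<longlonglongrightarrow> indicator A \<omega> * g \<omega>"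
      by (rule AE_I2) (auto simp: indicator_def D_lim)
    \<comment> \<open>Since \<open>K n\<close> is non-negative, \<open>D n \<omega>\<close> equals
      \<open>g \<omega>\<close> if this is non-negative, and otherwise lies between
      \<open>g \<omega>\<close> and 0.\<close>
    show "AE \<omega> in M. norm (indicator A \<omega> * D n \<omega>) \<le> \<bar>g \<omega>\<bar>" for n
    proof (rule AE_I2)
      fix \<omega>
      show "norm (indicator A \<omega> * D n \<omega>) \<le> \<bar>g \<omega>\<bar>"
        using K_nonneg[of n "\<sigma> \<omega>"] by (auto simp: D_def indicator_def max_def)
    qed
  qed (use g in auto)
  have nonneg: "0 \<le> (\<integral>\<omega>. indicator A \<omega> * D n \<omega> \<partial>M)" for n
  proof -
    have int1: "integrable M (\<lambda>\<omega>. indicator A \<omega> * K n \<omega>)" for n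
      using integrable_real_mult_indicator[OF A_sets K_int[of n]] by (simp add: mult.commute)
    have shift_eq: "indicator A \<omega> = (indicator A (\<sigma> \<omega>) :: real)" if "\<omega> \<in> space M" for \<omega>
      using A_inv[OF that] by (auto simp: indicator_def)
    have "(\<integral>\<omega>. indicator A \<omega> * D n \<omega> \<partial>M) =
        (\<integral>\<omega>. indicator A \<omega> * K (Suc n) \<omega> - indicator A (\<sigma> \<omega>) * K n (\<sigma> \<omega>) \<partial>M)"
      by (intro Bochner_Integration.integral_cong) (auto simp: D_eq shift_eq right_diff_distrib)
    also have "\<dots> = (\<integral>\<omega>. indicator A \<omega> * K (Suc n) \<omega> \<partial>M) -
        (\<integral>\<omega>. indicator A (\<sigma> \<omega>) * K n (\<sigma> \<omega>) \<partial>M)"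
      using int1 integrable_base[OF int1] by (intro Bochner_Integration.integral_diff) auto
    also have "(\<integral>\<omega>. indicator A (\<sigma> \<omega>) * K n (\<sigma> \<omega>) \<partial>M) = (\<integral>\<omega>. indicator A \<omega> * K n \<omega> \<partial>M)"
      by (rule integral_base[where g = "\<lambda>\<omega>. indicator A \<omega> * K n \<omega>"]) measurable
    finally show ?thesis
      using integral_mono[OF int1[of n] int1[of "Suc n"]] K_mono
      by (simp add: mult_left_mono)
  qed
  have "0 \<le> (\<integral>\<omega>. indicator A \<omega> * g \<omega> \<partial>M)"
    using lim nonneg by (intro LIMSEQ_le_const) auto
  moreover have "(\<integral>\<omega>. indicator A \<omega> * g \<omega> \<partial>M) = (\<integral>\<omega>. g \<omega> \<partial>M)" if "prob A = 1"
  proof (rule integral_cong_AE)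
    have "AE \<omega> in M. \<omega> \<in> A" using that prob_eq_1[OF A_sets] by simp
    then show "AE \<omega> in M. indicator A \<omega> * g \<omega> = g \<omega>"
      by eventually_elim simp
  qed measurable
  moreover have "prob A = 0 \<or> prob A = 1"
    using A_inv sets.sets_into_space[OF A_sets] by (intro ergodic A_sets) auto
  ultimately have "prob A = 0"
    using neg by auto
  then have "AE \<omega> in M. \<omega> \<notin> A"
    using prob_eq_0[OF A_sets] by simp
  then show ?thesis
    using AE_space
  proof eventually_elim
    case (elim \<omega>)
    then obtain B :: nat where "\<And>n. S n \<omega> \<le> real B" by (auto simp: A_def not_less)
    then show ?case by (intro bdd_aboveI2[of _ _ "real B"]) (simp add: S_def)
  qed
qed

text \<open>For d strictly between the mean and c, the sums of \<open>g - d\<close> have negative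
  mean and so stay below some B; the gap \<open>(c - d) * n\<close> eventually exceeds B.\<close>

lemma AE_birkhoff_averages_eventually_less:
  fixes g :: "'w \<Rightarrow> real"
  assumes g: "integrable M g" and c: "(\<integral>\<omega>. g \<omega> \<partial>M) < c"
  shows "AE \<omega> in M. \<forall>\<^sub>F n in sequentially. (\<Sum>k<n. g ((\<sigma> ^^ k) \<omega>)) / real n < c"
proof -
  obtain d where d: "(\<integral>\<omega>. g \<omega> \<partial>M) < d" "d < c" using c dense by blast
  have "AE \<omega> in M. bdd_above (range (\<lambda>n. \<Sum>k<n. g ((\<sigma> ^^ k) \<omega>) - d))"
    using g d by (intro AE_bdd_above_birkhoff_sums) (auto simp: prob_space)
  then show ?thesis
  proof eventually_elim
    case (elim \<omega>)
    then obtain B where B: "\<And>n. (\<Sum>k<n. g ((\<sigma> ^^ k) \<omega>) - d) \<le> B"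
      by (auto simp: bdd_above_def)
    obtain n0 :: nat where n0: "B / (c - d) < real n0" using reals_Archimedean2 by blast
    have "(\<Sum>k<n. g ((\<sigma> ^^ k) \<omega>)) / real n < c" if n: "n \<ge> Suc n0" for n
    proof -
      have "B / (c - d) < real n" using n0 n by simp
      then have "B < (c - d) * real n"
        using d by (simp add: field_simps)
      then have "(\<Sum>k<n. g ((\<sigma> ^^ k) \<omega>)) < c * real n"
        using B[of n] by (simp add: sum_subtractf algebra_simps)
      then show ?thesis using n by (simp add: field_simps)
    qed
    then show ?case by (auto simp: eventually_sequentially)
  qed
qed

text \<open>The one-sided estimate is used for \<open>g\<close> and for \<open>- g\<close>, with the
  countably many margins \<open>1 / real (Suc j)\<close>.\<close>

theorem AE_birkhoff:
  fixes g :: "'w \<Rightarrow> real"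
  assumes g: "integrable M g"
  shows "AE \<omega> in M. (\<lambda>n. (\<Sum>k<n. g ((\<sigma> ^^ k) \<omega>)) / real n) \<longlonglongrightarrow> (\<integral>\<omega>. g \<omega> \<partial>M)"
proof -
  define I where "I = (\<integral>\<omega>. g \<omega> \<partial>M)"
  have "AE \<omega> in M. \<forall>j. \<forall>\<^sub>F n in sequentially.
      (\<Sum>k<n. g ((\<sigma> ^^ k) \<omega>)) / real n < I + 1 / real (Suc j)"
    using g by (subst AE_all_countable)
      (auto simp: I_def intro!: AE_birkhoff_averages_eventually_less)
  moreover have "AE \<omega> in M. \<forall>j. \<forall>\<^sub>F n in sequentially.
      (\<Sum>k<n. - g ((\<sigma> ^^ k) \<omega>)) / real n < - I + 1 / real (Suc j)"
    using g by (subst AE_all_countable)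
      (auto simp: I_def intro!: AE_birkhoff_averages_eventually_less[of "\<lambda>\<omega>. - g \<omega>"])
  ultimately show ?thesis
  proof eventually_elim
    case (elim \<omega>)
    have "(\<lambda>n. (\<Sum>k<n. g ((\<sigma> ^^ k) \<omega>)) / real n) \<longlonglongrightarrow> I"
    proof (rule tendstoI)
      fix e :: real assume "0 < e"
      then obtain j where j: "1 / real (Suc j) < e"
        using nat_approx_posE by blast
      show "\<forall>\<^sub>F n in sequentially. dist ((\<Sum>k<n. g ((\<sigma> ^^ k) \<omega>)) / real n) I < e"
        using elim(1)[rule_format, of j] elim(2)[rule_format, of j]
        by eventually_elim (use j in \<open>auto simp: dist_real_def sum_negf\<close>)
    qed
    then show ?case by (simp add: I_def)
  qed
qed

end

section \<open>Degree-one maps and their monotone envelopes\<close>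

lemma End1_real_continuous:
  assumes "F \<in> End1_real"
  shows "continuous_on S F"
  using assms continuous_on_subset by (auto simp: End1_real_def)

lemma End1_real_add_of_nat:
  assumes "F \<in> End1_real"
  shows "F (x + of_nat n) = F x + of_nat n"
proof (induction n)
  case (Suc n)
  have "F (x + of_nat n + 1) = F (x + of_nat n) + 1"
    using assms by (simp add: End1_real_def)
  with Suc show ?case by (simp add: algebra_simps)
qed simp

lemma End1_real_add_of_int:
  assumes "F \<in> End1_real"
  shows "F (x + of_int k) = F x + of_int k"
proof (cases k rule: int_cases2)
  case (nonneg n)
  then show ?thesis using End1_real_add_of_nat[OF assms, of x n] by simp
next
  case (nonpos n)
  then show ?thesis using End1_real_add_of_nat[OF assms, of "x - of_nat n" n] by simp
qed

lemma id_End1_real: "id \<in> End1_real"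
  by (auto simp: End1_real_def continuous_on_id)

lemma comp_End1_real:
  assumes "F \<in> End1_real" "G \<in> End1_real"
  shows "F \<circ> G \<in> End1_real"
  using assms unfolding End1_real_def
  by (auto simp: o_def intro: continuous_on_compose2)

lemma dist_le_sup_dist_End1_real:
  assumes "F \<in> End1_real" "G \<in> End1_real"
  shows "\<bar>F x - G x\<bar> \<le> sup_dist F G"
  unfolding sup_dist_def using cSUP_upper[OF UNIV_I bdd_above_dist_End1_real[OF assms], of x]
  by (simp add: dist_real_def)

text \<open>An integer translation brings \<open>x\<close> into the unit interval; for points less
  than 1 apart, \<open>y\<close> then lies in the compact interval \<open>{-1..2}\<close>.\<close>

lemma End1_real_uniformly_continuous:
  assumes F: "F \<in> End1_real" and "0 < e"
  obtains d where "0 < d" "\<And>x y. \<bar>x - y\<bar> < d \<Longrightarrow> \<bar>F x - F y\<bar> < e"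
proof -
  have "uniformly_continuous_on {-1..2} F"
    using F by (intro compact_uniformly_continuous End1_real_continuous) auto
  then obtain d where d: "0 < d"
    "\<And>x y. x \<in> {-1..2} \<Longrightarrow> y \<in> {-1..2} \<Longrightarrow> dist y x < d \<Longrightarrow> dist (F y) (F x) < e"
    using \<open>0 < e\<close> unfolding uniformly_continuous_on_def by metis
  have "\<bar>F x - F y\<bar> < e" if xy: "\<bar>x - y\<bar> < min d 1" for x y
  proof -
    define k where "k = \<lfloor>x\<rfloor>"
    have "x - k \<in> {-1..2}" "y - k \<in> {-1..2}"
      using xy by (simp_all add: k_def) linarith+
    moreover have "dist (x - k) (y - k) < d" using xy by (simp add: dist_real_def)
    ultimately have "dist (F (x - k)) (F (y - k)) < e" using d(2) by blast
    then show ?thesis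
      using End1_real_add_of_int[OF F, of x "- k"] End1_real_add_of_int[OF F, of y "- k"]
      by (simp add: dist_real_def)
  qed
  with \<open>0 < d\<close> show ?thesis by (intro that[of "min d 1"]) auto
qed

section \<open>Upper and lower envelopes of a single map\<close>

definition upper_envelope :: "(real \<Rightarrow> real) \<Rightarrow> real \<Rightarrow> real" where
  "upper_envelope F x = (SUP y\<in>{..x}. F y)"

text \<open>Conjugation by the reflection of the line. It commutes with composition and exchanges
  infima over right half-lines with suprema over left ones, so everything about lower maps follows
  from upper envelopes.\<close>

definition reflect :: "(real \<Rightarrow> real) \<Rightarrow> real \<Rightarrow> real" where
  "reflect F x = - F (- x)"

lemma reflect_comp: "reflect (F \<circ> G) = reflect F \<circ> reflect G"
  by (auto simp: reflect_def fun_eq_iff)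

lemma reflect_id: "reflect id = id"
  by (auto simp: reflect_def fun_eq_iff)

lemma reflect_End1_real:
  assumes "F \<in> End1_real"
  shows "reflect F \<in> End1_real"
proof -
  have "continuous_on UNIV (\<lambda>x. - F (- x))"
    by (intro continuous_intros continuous_on_compose2[OF End1_real_continuous[OF assms, of UNIV]])
      auto
  moreover have "F (- x - 1) = F (- x) - 1" for x
    using End1_real_add_of_int[OF assms, of "- x" "-1"] by simp
  ultimately show ?thesis
    by (auto simp: End1_real_def reflect_def)
qed

lemma upper_map_eq_upper_envelope: "upper_map F \<omega> = upper_envelope (F \<omega>)"
  by (auto simp: upper_map_def upper_envelope_def fun_eq_iff)

lemma lower_map_eq_reflect_upper_envelope:
  "lower_map F \<omega> = reflect (upper_envelope (reflect (F \<omega>)))"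
proof
  fix x
  have "uminus ` F \<omega> ` {x..} = reflect (F \<omega>) ` uminus ` {x..}"
    by (simp only: image_image reflect_def minus_minus)
  also have "uminus ` {x..} = {..- x}" by simp
  finally have "uminus ` F \<omega> ` {x..} = reflect (F \<omega>) ` {..- x}" .
  then show "lower_map F \<omega> x = reflect (upper_envelope (reflect (F \<omega>))) x"
    by (simp add: lower_map_def upper_envelope_def Inf_real_def reflect_def image_image)
qed

text \<open>Moving \<open>y\<close> up by a non-negative integer into the last period before
  \<open>x\<close> can only increase the value. Suprema over a half-line thus become maxima over a
  compact interval.\<close>

lemma End1_real_le_reduced_argument:
  assumes F: "F \<in> End1_real" and "y \<le> x"
  obtains y' where "y' \<in> {x - 1..x}" "F y \<le> F y'" "y \<le> y'"
proof
  define k where "k = \<lfloor>x - y\<rfloor>"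
  have k: "0 \<le> k" using \<open>y \<le> x\<close> by (simp add: k_def)
  show "y + k \<in> {x - 1..x}" by (simp add: k_def) linarith
  show "F y \<le> F (y + k)" using End1_real_add_of_int[OF F, of y k] k by simp
  show "y \<le> y + k" using k by simp
qed

lemma upper_envelope_attained:
  assumes F: "F \<in> End1_real"
  obtains z where "z \<in> {x - 1..x}" "upper_envelope F x = F z" "\<And>y. y \<le> x \<Longrightarrow> F y \<le> F z"
proof -
  obtain z where z: "z \<in> {x - 1..x}" "\<And>y. y \<in> {x - 1..x} \<Longrightarrow> F y \<le> F z"
    using continuous_attains_sup[of "{x - 1..x}" F] End1_real_continuous[OF F] by auto
  have le: "F y \<le> F z" if "y \<le> x" for y
    using End1_real_le_reduced_argument[OF F that] z(2) by (metis order_trans)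
  have "upper_envelope F x = F z"
    unfolding upper_envelope_def
    by (rule cSup_eq_maximum) (use z le in auto)
  with z le show ?thesis using that by blast
qed

lemma upper_envelope_ge:
  assumes "F \<in> End1_real" "y \<le> x"
  shows "F y \<le> upper_envelope F x"
  using upper_envelope_attained[OF assms(1), of x] assms(2) by metis

lemma upper_envelope_id: "upper_envelope id = id"
proof
  fix x :: real
  show "upper_envelope id x = id x"
    unfolding upper_envelope_def by (rule cSup_eq_maximum) auto
qed

lemma upper_envelope_mono:
  assumes F: "F \<in> End1_real" and "x \<le> y"
  shows "upper_envelope F x \<le> upper_envelope F y"
proof -
  obtain z where "z \<in> {x - 1..x}" "upper_envelope F x = F z"
    using upper_envelope_attained[OF F] by metis
  then show ?thesis using upper_envelope_ge[OF F, of z y] \<open>x \<le> y\<close> by simp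
qed

lemma upper_envelope_End1_real:
  assumes F: "F \<in> End1_real"
  shows "upper_envelope F \<in> End1_real"
proof -
  \<comment> \<open>Translating a maximiser by \<open>t\<close> gives a competitor for
    \<open>x + t\<close>. Small \<open>t\<close> yields continuity, and \<open>t\<close> equal to 1
    or -1 yields equivariance.\<close>
  have shift: "upper_envelope F x + (F (z + t) - F z) \<le> upper_envelope F (x + t)"
    if "z \<le> x" "upper_envelope F x = F z" for x z t
    using upper_envelope_ge[OF F, of "z + t" "x + t"] that by simp
  have "continuous_on UNIV (upper_envelope F)"
    unfolding continuous_on_iff
  proof (intro ballI allI impI)
    fix x e :: real
    assume "0 < e"
    obtain d where d: "0 < d" "\<And>x y. \<bar>x - y\<bar> < d \<Longrightarrow> \<bar>F x - F y\<bar> < e"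
      using End1_real_uniformly_continuous[OF F \<open>0 < e\<close>] by blast
    have less: "upper_envelope F x < upper_envelope F y + e" if "\<bar>x - y\<bar> < d" for x y
    proof -
      obtain z where z: "z \<in> {x - 1..x}" "upper_envelope F x = F z"
        using upper_envelope_attained[OF F] by metis
      have "upper_envelope F x + (F (z + (y - x)) - F z) \<le> upper_envelope F y"
        using shift[of z x "y - x"] z by simp
      moreover have "\<bar>F (z + (y - x)) - F z\<bar> < e"
        using that by (intro d(2)) auto
      ultimately show ?thesis by linarith
    qed
    show "\<exists>d>0. \<forall>y\<in>UNIV. dist y x < d \<longrightarrow> dist (upper_envelope F y) (upper_envelope F x) < e"
    proof (intro exI[of _ d] conjI ballI impI \<open>0 < d\<close>)
      fix y assume "dist y x < d"
      then show "dist (upper_envelope F y) (upper_envelope F x) < e"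
        using less[of x y] less[of y x] by (simp add: dist_real_def abs_minus_commute)
    qed
  qed
  moreover have "upper_envelope F (x + 1) = upper_envelope F x + 1" for x
  proof (rule antisym)
    obtain z where z: "z \<in> {x + 1 - 1..x + 1}" "upper_envelope F (x + 1) = F z"
      using upper_envelope_attained[OF F, of "x + 1"] by metis
    then show "upper_envelope F (x + 1) \<le> upper_envelope F x + 1"
      using shift[of z "x + 1" "-1"] End1_real_add_of_int[OF F, of z "-1"] by simp
    obtain z where z: "z \<in> {x - 1..x}" "upper_envelope F x = F z"
      using upper_envelope_attained[OF F] by metis
    then show "upper_envelope F x + 1 \<le> upper_envelope F (x + 1)"
      using shift[of z x 1] End1_real_add_of_int[OF F, of z 1] by simp
  qed
  ultimately show ?thesis by (simp add: End1_real_def)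
qed

text \<open>One inequality is monotonicity. For the other, the maximiser of \<open>F\<close> to the
  left of \<open>G y\<close> lies in \<open>{G y - 1..G y}\<close>, whose end points are
  \<open>G (y - 1)\<close> and \<open>G y\<close>; by the intermediate value theorem it is a value
  of \<open>G\<close> to the left of \<open>y\<close>.\<close>

lemma upper_envelope_comp:
  assumes F: "F \<in> End1_real" and G: "G \<in> End1_real"
  shows "upper_envelope (F \<circ> G) = upper_envelope F \<circ> upper_envelope G"
proof
  fix x
  note FG = comp_End1_real[OF F G]
  show "upper_envelope (F \<circ> G) x = (upper_envelope F \<circ> upper_envelope G) x"
  proof (rule antisym)
    obtain z where z: "z \<in> {x - 1..x}" "upper_envelope (F \<circ> G) x = F (G z)"
      using upper_envelope_attained[OF FG, of x] by (metis comp_apply)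
    then have "G z \<le> upper_envelope G x" using upper_envelope_ge[OF G] by simp
    then show "upper_envelope (F \<circ> G) x \<le> (upper_envelope F \<circ> upper_envelope G) x"
      using z upper_envelope_ge[OF F] by simp
  next
    obtain y where y: "y \<in> {x - 1..x}" "upper_envelope G x = G y"
      using upper_envelope_attained[OF G] by metis
    obtain z where z: "z \<in> {G y - 1..G y}" "upper_envelope F (G y) = F z"
      using upper_envelope_attained[OF F] by metis
    have "G (y - 1) = G y - 1"
      using End1_real_add_of_int[OF G, of y "-1"] by simp
    then obtain y' where "y' \<in> {y - 1..y}" "G y' = z"
      using IVT'[of G "y - 1" z y] End1_real_continuous[OF G] z by auto
    then show "(upper_envelope F \<circ> upper_envelope G) x \<le> upper_envelope (F \<circ> G) x"
      using upper_envelope_ge[OF FG, of y' x] y z by simp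
  qed
qed

lemma End1_real_surj:
  assumes F: "F \<in> End1_real"
  shows "\<exists>x. F x = y"
proof -
  define k where "k = \<lfloor>y - F 0\<rfloor>"
  have "F k = F 0 + k" "F (k + 1) = F 0 + k + 1"
    using End1_real_add_of_int[OF F, of 0 k] End1_real_add_of_int[OF F, of 0 "k + 1"] by simp_all
  moreover have "F 0 + k \<le> y" "y \<le> F 0 + k + 1"
    unfolding k_def by linarith+
  ultimately show ?thesis
    using IVT'[of F k y "k + 1"] End1_real_continuous[OF F] by auto
qed

text \<open>Monotonicity traps \<open>F x\<close> between the values of \<open>F\<close> at two
  consecutive integer translates of \<open>y\<close>. This is the source of the error 1 in almost
  additivity.\<close>

lemma End1_real_mono_displacement:
  assumes F: "F \<in> End1_real" and "mono F"
  shows "\<bar>F x - F y - (x - y)\<bar> \<le> 1"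
proof -
  define k where "k = \<lfloor>x - y\<rfloor>"
  have "F (y + k) \<le> F x" "F x \<le> F (y + (k + 1))"
    using \<open>mono F\<close> by (auto intro!: monoD[of F] simp: k_def) linarith+
  moreover have "F (y + k) = F y + k" "F (y + (k + 1)) = F y + (k + 1)"
    using End1_real_add_of_int[OF F, of y k] End1_real_add_of_int[OF F, of y "k + 1"] by simp_all
  moreover have "k \<le> x - y" "x - y \<le> k + 1" unfolding k_def by linarith+
  ultimately show ?thesis by linarith
qed

section \<open>Envelopes along a cocycle, and oscillation\<close>

lemma cocycle_add:
  "cocycle \<sigma> G (m + n) \<omega> = cocycle \<sigma> G m ((\<sigma> ^^ n) \<omega>) \<circ> cocycle \<sigma> G n \<omega>"
  by (induction m) (simp_all add: funpow_add comp_assoc)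

lemma cocycle_End1_real:
  assumes "\<And>k. k < n \<Longrightarrow> G ((\<sigma> ^^ k) \<omega>) \<in> End1_real"
  shows "cocycle \<sigma> G n \<omega> \<in> End1_real"
  using assms by (induction n) (auto intro: id_End1_real comp_End1_real)

lemma cocycle_reflect:
  "cocycle \<sigma> (\<lambda>\<omega>. reflect (G \<omega>)) n \<omega> = reflect (cocycle \<sigma> G n \<omega>)"
  by (induction n) (simp_all only: cocycle.simps reflect_id reflect_comp)

lemma cocycle_upper_envelope:
  assumes "\<And>k. G ((\<sigma> ^^ k) \<omega>) \<in> End1_real"
  shows "cocycle \<sigma> (\<lambda>\<omega>. upper_envelope (G \<omega>)) n \<omega> = upper_envelope (cocycle \<sigma> G n \<omega>)"
  using assms
  by (induction n) (simp_all add: upper_envelope_id upper_envelope_comp cocycle_End1_real)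

text \<open>By periodicity, the two halves of an interval of length two see the supremum over the left and
  the infimum over the right half-line from its midpoint.\<close>

lemma End1_real_oscillation:
  assumes F: "F \<in> End1_real"
  obtains y z where "y \<in> {a..a + 2}" "z \<in> {a..a + 2}"
    "upper_envelope F 0 - reflect (upper_envelope (reflect F)) 0 - 1 \<le> F y - F z"
proof -
  \<comment> \<open>The integers \<open>k\<close> and \<open>k + 1\<close> enclose the midpoint. The
    maximum to its left is compared with the upper envelope at \<open>k\<close>, the minimum to its
    right with the lower one at \<open>k + 1\<close>; the difference of the two integers is the lost
    1.\<close>
  define k where "k = \<lfloor>a + 1\<rfloor>"
  have k: "k \<le> a + 1" "a + 1 \<le> k + 1" unfolding k_def by linarith+
  note RF = reflect_End1_real[OF F]
  obtain y where y: "y \<in> {a + 1 - 1..a + 1}" "upper_envelope F (a + 1) = F y"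
    using upper_envelope_attained[OF F, of "a + 1"] by metis
  obtain z where z: "z \<in> {- (a + 1) - 1..- (a + 1)}"
    "upper_envelope (reflect F) (- (a + 1)) = reflect F z"
    using upper_envelope_attained[OF RF, of "- (a + 1)"] by metis
  have "upper_envelope F 0 + k \<le> F y"
    using upper_envelope_mono[OF F k(1)] y
      End1_real_add_of_int[OF upper_envelope_End1_real[OF F], of 0 k] by simp
  moreover have "upper_envelope (reflect F) 0 - (k + 1) \<le> reflect F z"
    using upper_envelope_mono[OF RF, of "- (k + 1)" "- (a + 1)"] k z
      End1_real_add_of_int[OF upper_envelope_End1_real[OF RF], of 0 "- (k + 1)"] by simp
  ultimately have "upper_envelope F 0 - reflect (upper_envelope (reflect F)) 0 - 1 \<le> F y - F (- z)"
    by (simp add: reflect_def)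
  then show ?thesis using y z by (intro that[of y "- z"]) auto
qed

section \<open>Rotation numbers\<close>

text \<open>Rounding \<open>g\<close> down to the grid of step \<open>1 / real (Suc i)\<close>
  leaves countably many values, for which measurability is inherited; continuity of
  \<open>H \<omega>\<close> handles the limit. This is what makes a composition of random maps
  measurable.\<close>

lemma borel_measurable_Caratheodory:
  fixes H :: "'w \<Rightarrow> real \<Rightarrow> real"
  assumes meas: "\<And>x. (\<lambda>\<omega>. H \<omega> x) \<in> borel_measurable M"
    and cont: "\<And>\<omega>. \<omega> \<in> space M \<Longrightarrow> continuous_on UNIV (H \<omega>)"
    and g [measurable]: "g \<in> borel_measurable M"
  shows "(\<lambda>\<omega>. H \<omega> (g \<omega>)) \<in> borel_measurable M"
proof (rule borel_measurable_LIMSEQ_real)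
  define d where "d i \<omega> = \<lfloor>g \<omega> * real (Suc i)\<rfloor>" for i \<omega>
  have [measurable]: "d i \<in> measurable M (count_space UNIV)" for i
    unfolding d_def by measurable
  show "(\<lambda>\<omega>. H \<omega> (real_of_int (d i \<omega>) / real (Suc i))) \<in> borel_measurable M" for i
    by (rule measurable_compose_countable[where f = "\<lambda>k \<omega>. H \<omega> (real_of_int k / real (Suc i))"])
      (auto intro: meas)
  fix \<omega> assume \<omega>: "\<omega> \<in> space M"
  have "(\<lambda>i. real_of_int (d i \<omega>) / real (Suc i)) \<longlonglongrightarrow> g \<omega>"
  proof (rule tendsto_sandwich)
    show "\<forall>\<^sub>F i in sequentially. g \<omega> - 1 / real (Suc i) \<le> real_of_int (d i \<omega>) / real (Suc i)"
    proof (rule always_eventually, rule allI)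
      fix i
      have "g \<omega> * real (Suc i) - 1 \<le> real_of_int (d i \<omega>)"
        unfolding d_def by linarith
      then show "g \<omega> - 1 / real (Suc i) \<le> real_of_int (d i \<omega>) / real (Suc i)"
        by (simp add: le_divide_eq left_diff_distrib del: of_nat_Suc)
    qed
    show "\<forall>\<^sub>F i in sequentially. real_of_int (d i \<omega>) / real (Suc i) \<le> g \<omega>"
      by (rule always_eventually) (simp add: d_def divide_le_eq del: of_nat_Suc)
    show "(\<lambda>i. g \<omega> - 1 / real (Suc i)) \<longlonglongrightarrow> g \<omega>"
      using tendsto_diff[OF tendsto_const LIMSEQ_inverse_real_of_nat, of "g \<omega>"]
      by (simp add: inverse_eq_divide)
  qed simp
  then show "(\<lambda>i. H \<omega> (real_of_int (d i \<omega>) / real (Suc i))) \<longlonglongrightarrow> H \<omega> (g \<omega>)"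
    using cont[OF \<omega>] by (auto intro: continuous_on_tendsto_compose)
qed

text \<open>Both sides are the double sum of the increments
  \<open>\<phi> (l + j + 1) - \<phi> (l + j)\<close> over \<open>l < n\<close> and
  \<open>j < m\<close>, telescoped in one index or in the other.\<close>

lemma sum_shift_difference:
  fixes \<phi> :: "nat \<Rightarrow> real"
  shows "(\<Sum>l<n. \<phi> (l + m) - \<phi> l) = (\<Sum>j<m. \<phi> (n + j) - \<phi> j)"
proof (induction n)
  case (Suc n)
  have "(\<Sum>j<m. \<phi> (Suc n + j) - \<phi> j) - (\<Sum>j<m. \<phi> (n + j) - \<phi> j) =
      (\<Sum>j<m. \<phi> (n + Suc j) - \<phi> (n + j))"
    by (simp add: sum_subtractf)
  also have "\<dots> = \<phi> (n + m) - \<phi> n"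
    by (subst sum_lessThan_telescope) simp
  finally show ?case using Suc by simp
qed simp

lemma shifted_increment_tendsto_0:
  fixes \<phi> :: "nat \<Rightarrow> real"
  assumes "(\<lambda>n. (\<phi> (Suc n) - \<phi> n) / real n) \<longlonglongrightarrow> 0"
  shows "(\<lambda>n. (\<phi> (n + j) - \<phi> n) / real n) \<longlonglongrightarrow> 0"
proof (induction j)
  case (Suc j)
  have "(\<lambda>n. (\<phi> (Suc (n + j)) - \<phi> (n + j)) / real (n + j)) \<longlonglongrightarrow> 0"
    using LIMSEQ_ignore_initial_segment[OF assms, of j] by simp
  moreover have "(\<lambda>n. real (n + j) / real n) \<longlonglongrightarrow> 1"
    by real_asymp
  ultimately have
    "(\<lambda>n. (\<phi> (Suc (n + j)) - \<phi> (n + j)) / real (n + j) * (real (n + j) / real n)) \<longlonglongrightarrow> 0 * 1"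
    by (rule tendsto_mult)
  then have "(\<lambda>n. (\<phi> (Suc (n + j)) - \<phi> (n + j)) / real n) \<longlonglongrightarrow> 0"
    by (auto elim!: Lim_transform_eventually
        intro!: eventually_mono[OF eventually_gt_at_top[of 0]])
  from tendsto_add[OF this Suc] show ?case
    by (simp add: add_divide_distrib diff_divide_distrib)
qed simp

text \<open>The average of the \<open>m\<close>-step increments telescopes to \<open>m\<close> terms
  near time n and \<open>m\<close> fixed terms at the start. With sublinear one-step increments,
  each of the former is \<open>\<phi> n\<close> up to o(n).\<close>

lemma averaged_shift_difference_tendsto_0:
  fixes \<phi> :: "nat \<Rightarrow> real"
  assumes "(\<lambda>n. (\<phi> (Suc n) - \<phi> n) / real n) \<longlonglongrightarrow> 0"
  shows "(\<lambda>n. (\<Sum>l<n. \<phi> (l + m) - \<phi> l) / real n - real m * (\<phi> n / real n)) \<longlonglongrightarrow> 0"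
proof -
  have "(\<lambda>n. (\<Sum>j<m. (\<phi> (n + j) - \<phi> n) / real n) - (\<Sum>j<m. \<phi> j) / real n) \<longlonglongrightarrow> (\<Sum>j<m. 0) - 0"
    by (intro tendsto_diff tendsto_sum shifted_increment_tendsto_0 assms lim_const_over_n)
  moreover have "(\<Sum>j<m. (\<phi> (n + j) - \<phi> n) / real n) - (\<Sum>j<m. \<phi> j) / real n =
      (\<Sum>l<n. \<phi> (l + m) - \<phi> l) / real n - real m * (\<phi> n / real n)" for n
    unfolding sum_shift_difference
    by (simp add: sum_subtractf diff_divide_distrib sum_divide_distrib)
  ultimately show ?thesis by simp
qed

text \<open>The bound \<open>b\<close> stands for the norm of \<open>G \<omega> - id\<close>. It is
  kept as a parameter because one and the same \<open>b\<close> also serves the envelope and the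
  reflection of \<open>G\<close>.\<close>

locale integrable_degree_one_cocycle = ergodic_base +
  fixes G :: "'a \<Rightarrow> real \<Rightarrow> real" and b :: "'a \<Rightarrow> real"
  assumes End1: "\<omega> \<in> space M \<Longrightarrow> G \<omega> \<in> End1_real"
    and G_measurable: "(\<lambda>\<omega>. G \<omega> x) \<in> borel_measurable M"
    and b_integrable: "integrable M b"
    and displacement_le: "\<omega> \<in> space M \<Longrightarrow> \<bar>G \<omega> x - x\<bar> \<le> b \<omega>"
begin

lemma End1_iterate: "\<omega> \<in> space M \<Longrightarrow> G ((\<sigma> ^^ k) \<omega>) \<in> End1_real"
  by (intro End1 base_iterate_space)

lemma cocycle_End1: "\<omega> \<in> space M \<Longrightarrow> cocycle \<sigma> G n \<omega> \<in> End1_real"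
  by (intro cocycle_End1_real End1_iterate)

lemma cocycle_measurable [measurable]: "(\<lambda>\<omega>. cocycle \<sigma> G n \<omega> x) \<in> borel_measurable M"
proof (induction n)
  case (Suc n)
  have "(\<lambda>\<omega>. G ((\<sigma> ^^ n) \<omega>) (cocycle \<sigma> G n \<omega> x)) \<in> borel_measurable M"
  proof (rule borel_measurable_Caratheodory[OF _ _ Suc])
    show "(\<lambda>\<omega>. G ((\<sigma> ^^ n) \<omega>) x) \<in> borel_measurable M" for x
      by (rule measurable_compose[OF base_iterate_measurable G_measurable])
  qed (intro End1_real_continuous End1_iterate)
  then show ?case by simp
qed simp

lemma cocycle_integrable: "integrable M (\<lambda>\<omega>. cocycle \<sigma> G n \<omega> x)"
proof (induction n)
  case (Suc n)
  have "integrable M (\<lambda>\<omega>. b ((\<sigma> ^^ n) \<omega>) + \<bar>cocycle \<sigma> G n \<omega> x\<bar>)"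
    using integrable_base_iterate[OF b_integrable] Suc by auto
  then show ?case
  proof (rule Bochner_Integration.integrable_bound[OF _ cocycle_measurable])
    show "AE \<omega> in M. norm (cocycle \<sigma> G (Suc n) \<omega> x)
        \<le> norm (b ((\<sigma> ^^ n) \<omega>) + \<bar>cocycle \<sigma> G n \<omega> x\<bar>)"
    proof (rule AE_I2)
      fix \<omega> assume "\<omega> \<in> space M"
      from displacement_le[OF base_iterate_space[OF this], of n "cocycle \<sigma> G n \<omega> x"]
      show "norm (cocycle \<sigma> G (Suc n) \<omega> x) \<le> norm (b ((\<sigma> ^^ n) \<omega>) + \<bar>cocycle \<sigma> G n \<omega> x\<bar>)"
        by simp
    qed
  qed
qed simp

text \<open>The quotient is the difference of \<open>S (Suc n) / n\<close> and
  \<open>S n / n\<close> for the Birkhoff sums \<open>S\<close> of \<open>b\<close>, which have the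
  same finite limit.\<close>

lemma AE_b_iterate_tendsto_0: "AE \<omega> in M. (\<lambda>n. b ((\<sigma> ^^ n) \<omega>) / real n) \<longlonglongrightarrow> 0"
  using AE_birkhoff[OF b_integrable]
proof eventually_elim
  case (elim \<omega>)
  define S where "S n = (\<Sum>k<n. b ((\<sigma> ^^ k) \<omega>))" for n
  have lim: "(\<lambda>n. S n / real n) \<longlonglongrightarrow> (\<integral>\<omega>. b \<omega> \<partial>M)"
    using elim by (simp add: S_def)
  have "(\<lambda>n. real (Suc n) / real n) \<longlonglongrightarrow> 1"
    by real_asymp
  from tendsto_mult[OF LIMSEQ_Suc[OF lim] this]
  have "(\<lambda>n. S (Suc n) / real n) \<longlonglongrightarrow> (\<integral>\<omega>. b \<omega> \<partial>M)"
    by (simp del: of_nat_Suc)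
  from tendsto_diff[OF this lim] show ?case
    by (simp add: S_def add_divide_distrib)
qed

text \<open>The bound \<open>b\<close> survives since the envelope at \<open>x\<close> is at least
  \<open>G \<omega> x\<close> and is attained at some point to the left of \<open>x\<close>.\<close>

lemma upper_envelope_cocycle:
  "integrable_degree_one_cocycle M \<sigma> (\<lambda>\<omega>. upper_envelope (G \<omega>)) b"
proof
  fix \<omega> x
  assume \<omega>: "\<omega> \<in> space M"
  then show "upper_envelope (G \<omega>) \<in> End1_real"
    by (intro upper_envelope_End1_real End1)
  obtain z where "z \<in> {x - 1..x}" "upper_envelope (G \<omega>) x = G \<omega> z"
    using upper_envelope_attained[OF End1[OF \<omega>]] by metis
  then show "\<bar>upper_envelope (G \<omega>) x - x\<bar> \<le> b \<omega>"
    using upper_envelope_ge[OF End1[OF \<omega>], of x x] displacement_le[OF \<omega>, of z]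
      displacement_le[OF \<omega>, of x] by auto
next
  fix x
  \<comment> \<open>By continuity, rational offsets suffice in the supremum, which makes it
    countable and hence measurable.\<close>
  define Q where "Q = {q \<in> \<rat>. q \<le> (0 :: real)}"
  have Q: "countable Q" "Q \<noteq> {}"
    using countable_rat by (auto simp: Q_def intro: countable_subset[of _ \<rat>])
  have bdd: "bdd_above ((\<lambda>q. G \<omega> (x + q)) ` Q)" if "\<omega> \<in> space M" for \<omega>
    using upper_envelope_ge[OF End1[OF that], of "x + q" x for q]
    by (intro bdd_aboveI2[of _ _ "upper_envelope (G \<omega>) x"]) (auto simp: Q_def)
  have eq: "upper_envelope (G \<omega>) x = (SUP q\<in>Q. G \<omega> (x + q))" if \<omega>: "\<omega> \<in> space M" for \<omega>
  proof (rule antisym)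
    obtain z where z: "z \<in> {x - 1..x}" "upper_envelope (G \<omega>) x = G \<omega> z"
      using upper_envelope_attained[OF End1[OF \<omega>]] by metis
    show "upper_envelope (G \<omega>) x \<le> (SUP q\<in>Q. G \<omega> (x + q))"
    proof (rule field_le_epsilon)
      fix e :: real
      assume "0 < e"
      then obtain d where d: "0 < d" "\<And>x y. \<bar>x - y\<bar> < d \<Longrightarrow> \<bar>G \<omega> x - G \<omega> y\<bar> < e"
        using End1_real_uniformly_continuous[OF End1[OF \<omega>]] by metis
      obtain q where q: "q \<in> \<rat>" "z - x - d < q" "q < z - x"
        using Rats_dense_in_real[of "z - x - d" "z - x"] \<open>0 < d\<close> by auto
      then have "q \<in> Q" "\<bar>z - (x + q)\<bar> < d" using z by (auto simp: Q_def)
      then have "G \<omega> z < G \<omega> (x + q) + e" "G \<omega> (x + q) \<le> (SUP q\<in>Q. G \<omega> (x + q))"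
        using d(2)[of z "x + q"] cSUP_upper[OF _ bdd[OF \<omega>], of q] by auto
      then show "upper_envelope (G \<omega>) x \<le> (SUP q\<in>Q. G \<omega> (x + q)) + e"
        using z by simp
    qed
    show "(SUP q\<in>Q. G \<omega> (x + q)) \<le> upper_envelope (G \<omega>) x"
      using Q upper_envelope_ge[OF End1[OF \<omega>]] by (intro cSUP_least) (auto simp: Q_def)
  qed
  have "(\<lambda>\<omega>. SUP q\<in>Q. G \<omega> (x + q)) \<in> borel_measurable M"
    using Q bdd by (intro borel_measurable_cSUP G_measurable)
  then show "(\<lambda>\<omega>. upper_envelope (G \<omega>) x) \<in> borel_measurable M"
    by (simp add: eq cong: measurable_cong)
qed (rule b_integrable)

lemma reflect_cocycle: "integrable_degree_one_cocycle M \<sigma> (\<lambda>\<omega>. reflect (G \<omega>)) b"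
proof
  fix \<omega> x
  assume \<omega>: "\<omega> \<in> space M"
  then show "reflect (G \<omega>) \<in> End1_real"
    by (intro reflect_End1_real End1)
  show "\<bar>reflect (G \<omega>) x - x\<bar> \<le> b \<omega>"
    using displacement_le[OF \<omega>, of "- x"] by (simp add: reflect_def abs_le_iff)
next
  show "(\<lambda>\<omega>. reflect (G \<omega>) x) \<in> borel_measurable M" for x
    unfolding reflect_def using G_measurable by measurable
qed (rule b_integrable)

end

locale monotone_degree_one_cocycle = integrable_degree_one_cocycle +
  assumes mono: "\<omega> \<in> space M \<Longrightarrow> mono (G \<omega>)"
begin

lemma mono_cocycle: "\<omega> \<in> space M \<Longrightarrow> mono (cocycle \<sigma> G n \<omega>)"
proof (induction n)
  case (Suc n)
  then show ?case
    using mono[OF base_iterate_space[OF Suc.prems], of n] by (simp add: mono_def)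
qed (simp add: mono_def)

text \<open>The monotone iterate over \<open>(\<sigma> ^^ n) \<omega>\<close> displaces
  \<open>cocycle \<sigma> G n \<omega> 0\<close> and 0 by amounts that differ by at most 1.\<close>

lemma cocycle_0_almost_additive:
  assumes "\<omega> \<in> space M"
  shows "\<bar>cocycle \<sigma> G (m + n) \<omega> 0 - cocycle \<sigma> G n \<omega> 0 - cocycle \<sigma> G m ((\<sigma> ^^ n) \<omega>) 0\<bar> \<le> 1"
proof -
  have \<omega>: "(\<sigma> ^^ n) \<omega> \<in> space M" using assms by (rule base_iterate_space)
  show ?thesis
    using End1_real_mono_displacement[OF cocycle_End1[OF \<omega>] mono_cocycle[OF \<omega>], of m "cocycle \<sigma> G n \<omega> 0" 0]
    unfolding cocycle_add by (simp add: algebra_simps)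
qed

text \<open>Theorem of Li and Lu over an ergodic base. Almost additivity of \<open>n \<mapsto> G\<^sup>(\<^sup>n\<^sup>) 0\<close> with error \<open>1\<close>
  replaces the subadditive ergodic theorem by Birkhoff's theorem for each iterate \<open>m\<close>, which
  controls the limit up to \<open>1/m\<close>.\<close>

theorem rotation_number_exists:
  "\<exists>c. \<forall>x. AE \<omega> in M. (\<lambda>n. (cocycle \<sigma> G n \<omega> x - x) / real n) \<longlonglongrightarrow> c"
proof -
  define \<phi> where "\<phi> n \<omega> = cocycle \<sigma> G n \<omega> 0" for n \<omega>
  define c where "c m = (\<integral>\<omega>. \<phi> m \<omega> \<partial>M) / real m" for m
  have "AE \<omega> in M. \<forall>m. (\<lambda>n. (\<Sum>k<n. \<phi> m ((\<sigma> ^^ k) \<omega>)) / real n) \<longlonglongrightarrow> (\<integral>\<omega>. \<phi> m \<omega> \<partial>M)"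
    unfolding \<phi>_def by (subst AE_all_countable) (intro allI AE_birkhoff cocycle_integrable)
  then have close: "AE \<omega> in M. \<forall>m e. 0 < m \<longrightarrow> 0 < e \<longrightarrow>
      (\<forall>\<^sub>F n in sequentially. \<bar>\<phi> n \<omega> / real n - c m\<bar> < 1 / real m + e)"
    using AE_b_iterate_tendsto_0 AE_space
  proof eventually_elim
    case (elim \<omega>)
    \<comment> \<open>One step moves a point by at most \<open>b ((\<sigma> ^^ n) \<omega>)\<close>,
      which is o(n) almost surely.\<close>
    have "(\<lambda>n. (\<phi> (Suc n) \<omega> - \<phi> n \<omega>) / real n) \<longlonglongrightarrow> 0"
    proof (rule Lim_null_comparison[OF _ elim(2)])
      show "\<forall>\<^sub>F n in sequentially. norm ((\<phi> (Suc n) \<omega> - \<phi> n \<omega>) / real n) \<le> b ((\<sigma> ^^ n) \<omega>) / real n"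
        using displacement_le[OF base_iterate_space[OF elim(3)]]
        by (intro always_eventually) (auto simp: \<phi>_def intro: divide_right_mono)
    qed
    note lim1 = averaged_shift_difference_tendsto_0[OF this]
    show ?case
    proof (intro allI impI)
      fix m :: nat and e :: real
      assume m: "0 < m" and e: "0 < e"
      \<comment> \<open>Each starting time \<open>l\<close> contributes an almost-additivity error
        of at most 1, and so does the average. Division by \<open>m\<close> later turns this into
        \<open>1 / real m\<close>.\<close>
      have bound: "\<bar>(\<Sum>l<n. \<phi> (l + m) \<omega> - \<phi> l \<omega>) / real n - (\<Sum>k<n. \<phi> m ((\<sigma> ^^ k) \<omega>)) / real n\<bar> \<le> 1" for n
      proof -
        have "\<bar>(\<Sum>l<n. \<phi> (l + m) \<omega> - \<phi> l \<omega>) - (\<Sum>k<n. \<phi> m ((\<sigma> ^^ k) \<omega>))\<bar> \<le>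
            (\<Sum>l<n. \<bar>\<phi> (l + m) \<omega> - \<phi> l \<omega> - \<phi> m ((\<sigma> ^^ l) \<omega>)\<bar>)"
          by (simp add: sum_subtractf[symmetric] sum_abs)
        also have "\<dots> \<le> (\<Sum>l<n. 1)"
          using cocycle_0_almost_additive[OF elim(3), of m]
          by (intro sum_mono) (simp add: \<phi>_def add.commute)
        finally show ?thesis
          by (cases "n = 0") (simp_all add: diff_divide_distrib[symmetric] abs_divide)
      qed
      have e': "0 < real m * e / 2" using m e by simp
      show "\<forall>\<^sub>F n in sequentially. \<bar>\<phi> n \<omega> / real n - c m\<bar> < 1 / real m + e"
        using tendstoD[OF lim1[of m] e'] tendstoD[OF elim(1)[rule_format, of m] e']
      proof eventually_elim
        case (elim n)
        have "\<bar>y - z\<bar> < 1 + real m * e"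
          if "dist (x - y) 0 < real m * e / 2" "dist x' z < real m * e / 2" "\<bar>x - x'\<bar> \<le> 1"
          for x x' y z :: real
          using that unfolding dist_real_def by linarith
        from this[OF elim bound]
        have "\<bar>real m * (\<phi> n \<omega> / real n) - (\<integral>\<omega>. \<phi> m \<omega> \<partial>M)\<bar> < 1 + real m * e" .
        also have "real m * (\<phi> n \<omega> / real n) - (\<integral>\<omega>. \<phi> m \<omega> \<partial>M) = real m * (\<phi> n \<omega> / real n - c m)"
          using m by (simp add: c_def right_diff_distrib)
        finally have "real m * \<bar>\<phi> n \<omega> / real n - c m\<bar> < 1 + real m * e"
          by (simp add: abs_mult)
        also have "1 + real m * e = real m * (1 / real m + e)"
          using m by (simp add: distrib_left)
        finally show ?case
          using m by simp
      qed
    qed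
  qed
  have c_close: "\<bar>c m - c m'\<bar> \<le> 1 / real m + 1 / real m'" if "0 < m" "0 < m'" for m m'
  proof (rule field_le_epsilon)
    fix e :: real assume e: "0 < e"
    \<comment> \<open>The \<open>c m\<close> are constants, so a single \<omega> outside the null
      set is enough to compare them through the common quotients
      \<open>\<phi> n \<omega> / real n\<close>.\<close>
    have "\<exists>\<omega>. \<forall>m e. 0 < m \<longrightarrow> 0 < e \<longrightarrow>
      (\<forall>\<^sub>F n in sequentially. \<bar>\<phi> n \<omega> / real n - c m\<bar> < 1 / real m + e)"
    proof (rule ccontr)
      assume "\<not> ?thesis"
      then have "AE \<omega> in M. False"
        by - (rule AE_mp[OF close AE_I2], blast)
      then show False by simp
    qed
    then obtain \<omega> where *: "\<And>m e. 0 < m \<Longrightarrow> 0 < e \<Longrightarrow>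
      (\<forall>\<^sub>F n in sequentially. \<bar>\<phi> n \<omega> / real n - c m\<bar> < 1 / real m + e)" by blast
    have "0 < e / 2" using e by simp
    from *[OF that(1) this] *[OF that(2) this]
    have "\<forall>\<^sub>F n in sequentially. \<bar>c m - c m'\<bar> \<le> 1 / real m + 1 / real m' + e"
      by eventually_elim linarith
    then show "\<bar>c m - c m'\<bar> \<le> 1 / real m + 1 / real m' + e" by simp
  qed
  have inv_lim: "(\<lambda>m. 1 / real m) \<longlonglongrightarrow> 0" by real_asymp
  have "Cauchy c"
  proof (rule metric_CauchyI)
    fix e :: real assume "0 < e"
    then obtain k where k: "1 / real (Suc k) < e / 2" using nat_approx_posE[of "e / 2"] by auto
    have "dist (c m) (c n) < e" if "m \<ge> Suc k" "n \<ge> Suc k" for m n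
    proof -
      have "1 / real m \<le> 1 / real (Suc k)" "1 / real n \<le> 1 / real (Suc k)"
        using that by (auto intro!: divide_left_mono)
      then show ?thesis using c_close[of m n] that k by (simp add: dist_real_def)
    qed
    then show "\<exists>K. \<forall>m\<ge>K. \<forall>n\<ge>K. dist (c m) (c n) < e" by blast
  qed
  then obtain L where L: "c \<longlonglongrightarrow> L" using Cauchy_convergent convergent_def by blast
  have "AE \<omega> in M. (\<lambda>n. (cocycle \<sigma> G n \<omega> x - x) / real n) \<longlonglongrightarrow> L" for x
    using close AE_space
  proof eventually_elim
    case (elim \<omega>)
    have "(\<lambda>n. \<phi> n \<omega> / real n) \<longlonglongrightarrow> L"
    proof (rule tendstoI)
      fix e :: real assume e: "0 < e"
      have "\<forall>\<^sub>F m in sequentially. dist (c m) L < e / 3 \<and> dist (1 / real m) 0 < e / 3 \<and> 0 < m"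
        using tendstoD[OF L, of "e / 3"] tendstoD[OF inv_lim, of "e / 3"] e
        by (intro eventually_conj eventually_gt_at_top) auto
      then obtain m where m: "dist (c m) L < e / 3" "1 / real m < e / 3" "0 < m"
        by (auto dest!: eventually_happens)
      have "\<forall>\<^sub>F n in sequentially. \<bar>\<phi> n \<omega> / real n - c m\<bar> < 1 / real m + e / 3"
        using elim(1) m e by simp
      then show "\<forall>\<^sub>F n in sequentially. dist (\<phi> n \<omega> / real n) L < e"
        by eventually_elim (use m in \<open>unfold dist_real_def, linarith\<close>)
    qed
    moreover have "(\<lambda>n. (cocycle \<sigma> G n \<omega> x - x) / real n - \<phi> n \<omega> / real n) \<longlonglongrightarrow> 0"
    proof (rule Lim_null_comparison[OF _ inv_lim])
      have "\<bar>cocycle \<sigma> G n \<omega> x - x - \<phi> n \<omega>\<bar> \<le> 1" for n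
        using End1_real_mono_displacement[OF cocycle_End1 mono_cocycle, OF elim(2) elim(2), of n x 0]
        by (simp add: \<phi>_def algebra_simps)
      then show "\<forall>\<^sub>F n in sequentially.
          norm ((cocycle \<sigma> G n \<omega> x - x) / real n - \<phi> n \<omega> / real n) \<le> 1 / real n"
        by (intro always_eventually)
          (auto simp: diff_divide_distrib[symmetric] intro: divide_right_mono)
    qed
    ultimately show ?case
      by (rule Lim_transform)
  qed
  then show ?thesis by blast
qed

text \<open>The constant function with the almost sure limit as its value shows that the choice in
  \<open>rotation_function\<close> has a candidate.\<close>

lemma rotation_function:
  shows "integrable M (rotation_function M \<sigma> G)"
    and "AE \<omega> in M. (\<lambda>n. (cocycle \<sigma> G n \<omega> x - x) / real n) \<longlonglongrightarrow> rotation_function M \<sigma> G \<omega>"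
proof -
  obtain c where "\<forall>x. AE \<omega> in M. (\<lambda>n. (cocycle \<sigma> G n \<omega> x - x) / real n) \<longlonglongrightarrow> c"
    using rotation_number_exists by blast
  then have "\<exists>r. integrable M r \<and>
      (\<forall>x. AE \<omega> in M. (\<lambda>n. (cocycle \<sigma> G n \<omega> x - x) / real n) \<longlonglongrightarrow> r \<omega>)"
    by (intro exI[of _ "\<lambda>_. c"]) simp
  from someI_ex[OF this] show "integrable M (rotation_function M \<sigma> G)"
    and "AE \<omega> in M. (\<lambda>n. (cocycle \<sigma> G n \<omega> x - x) / real n) \<longlonglongrightarrow> rotation_function M \<sigma> G \<omega>"
    unfolding rotation_function_def[symmetric] by blast+
qed

end

section \<open>Separated lifts\<close>

lemma infdist_Ints_eq: "infdist x \<int> = \<bar>x - of_int (round x)\<bar>" for x :: real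
proof (rule antisym)
  show "infdist x \<int> \<le> \<bar>x - of_int (round x)\<bar>"
    using infdist_le[of "of_int (round x)" \<int> x] by (simp add: dist_real_def)
  have "\<bar>x - of_int (round x)\<bar> \<le> dist x z" if "z \<in> \<int>" for z
  proof -
    obtain k where "z = of_int k" using \<open>z \<in> \<int>\<close> Ints_cases by blast
    then show ?thesis
      using round_diff_minimal[of x k] by (simp add: dist_real_def abs_minus_commute)
  qed
  then have "\<bar>x - of_int (round x)\<bar> \<le> (INF z\<in>\<int>. dist x z)"
    by (intro cINF_greatest) (auto intro: Ints_0)
  then show "\<bar>x - of_int (round x)\<bar> \<le> infdist x \<int>"
    by (metis Ints_0 empty_iff infdist_notempty)
qed

lemma infdist_Ints_le_abs: "infdist x \<int> \<le> \<bar>x\<bar>" for x :: real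
  using infdist_le[of 0 \<int> x] by simp

lemma dist_proj: "dist (proj x) (proj y) = infdist (x - y) \<int>"
  by transfer simp

lemma proj_eq_iff: "proj x = proj y \<longleftrightarrow> x - y \<in> \<int>"
  by transfer simp

lemma proj_surj_unit: "\<exists>x\<in>{0..<1}. p = proj x"
proof -
  obtain y where y: "p = proj y"
    by transfer auto
  have "proj y = proj (frac y)" by (simp add: proj_eq_iff frac_def)
  then show ?thesis using y frac_lt_1[of y] by (intro bexI[of _ "frac y"]) auto
qed

lemma le_bowen_dist_iff:
  assumes "0 < n"
  shows "e \<le> bowen_dist \<sigma> f \<omega> n x y \<longleftrightarrow>
    (\<exists>k<n. e \<le> dist (cocycle \<sigma> f k \<omega> x) (cocycle \<sigma> f k \<omega> y))"
  using assms unfolding bowen_dist_def by (subst Max_ge_iff) auto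

text \<open>The image of the interval is connected, so every point of \<open>Q\<close> has a
  preimage in it; choosing one for each pulls \<open>Q\<close> back without changing its
  cardinality.\<close>

lemma End1_real_preimage_set:
  assumes F: "F \<in> End1_real" and "z \<in> {a..a + 2}" "y \<in> {a..a + 2}" and "Q \<subseteq> {F z..F y}"
  obtains P where "P \<subseteq> {a..a + 2}" "inj_on F P" "F ` P = Q"
proof -
  have "connected (F ` {a..a + 2})"
    by (intro connected_continuous_image End1_real_continuous F) simp
  then have "{F z..F y} \<subseteq> F ` {a..a + 2}"
    using assms by (auto simp: connected_iff_interval)
  with \<open>Q \<subseteq> _\<close> have "Q \<subseteq> F ` {a..a + 2}" by blast
  then show ?thesis using that by (auto simp: subset_image_inj)
qed

text \<open>The point is the integer part: for \<open>e \<le> 1 / 4\<close>, points less than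
  \<open>e\<close> apart have images whose difference cannot be \<open>e\<close>-close to a nonzero
  integer.\<close>

definition almost_isometric :: "real \<Rightarrow> (real \<Rightarrow> real) \<Rightarrow> bool" where
  "almost_isometric e F \<longleftrightarrow> (\<forall>x y. \<bar>x - y\<bar> < e \<longrightarrow> \<bar>F x - F y\<bar> \<le> 1 / 2)"

section \<open>Many separated orbits on the line\<close>

context integrable_degree_one_cocycle
begin

text \<open>The constant \<open>7\<close> leaves an oscillation of \<open>6 = 2 + 2 + 2\<close> on each interval of length two.\<close>

definition strong_shear :: "nat \<Rightarrow> 'a \<Rightarrow> bool" where
  "strong_shear N \<omega> \<longleftrightarrow> 7 \<le> upper_envelope (cocycle \<sigma> G N \<omega>) 0
     - reflect (upper_envelope (reflect (cocycle \<sigma> G N \<omega>))) 0"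

text \<open>Greedy horseshoe construction: at a time of strong shear the image of an interval of length
  two contains two such intervals at distance two, and the construction then jumps \<open>N\<close> steps ahead.
  At other times it moves one step, since the image of an interval of length two contains one of
  length two.\<close>

lemma exists_separated_lifts:
  assumes "\<omega> \<in> space M" and N: "0 < N"
  shows "\<exists>P g. finite P \<and> P \<subseteq> {a..a + 2} \<and> 2 ^ g \<le> card P \<and>
    card {l. l < n \<and> strong_shear N ((\<sigma> ^^ l) \<omega>)} \<le> (g + 1) * N \<and>
    (\<forall>x\<in>P. \<forall>y\<in>P. x \<noteq> y \<longrightarrow> (\<exists>k\<le>n. 1 \<le> \<bar>cocycle \<sigma> G k \<omega> x - cocycle \<sigma> G k \<omega> y\<bar>))"
  using assms(1)
proof (induction n arbitrary: \<omega> a rule: less_induct)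
  case (less n)
  note \<omega> = \<open>\<omega> \<in> space M\<close>
  let ?S = "\<lambda>n \<omega>. {l. l < n \<and> strong_shear N ((\<sigma> ^^ l) \<omega>)}"
  consider "n < N" | "N \<le> n" "strong_shear N \<omega>" | "N \<le> n" "\<not> strong_shear N \<omega>"
    by linarith
  then show ?case
  proof cases
    case 1
    \<comment> \<open>A single point suffices here: fewer than \<open>N\<close> times are counted,
      and the \<open>+ 1\<close> in \<open>(g + 1) * N\<close> pays for them.\<close>
    have "card (?S n \<omega>) \<le> card {..<n}" by (intro card_mono) auto
    with 1 show ?thesis by (intro exI[of _ "{a}"] exI[of _ 0]) auto
  next
    case 2
    define \<Phi> where "\<Phi> = cocycle \<sigma> G N \<omega>"
    define \<omega>' where "\<omega>' = (\<sigma> ^^ N) \<omega>"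
    have \<Phi>: "\<Phi> \<in> End1_real" unfolding \<Phi>_def by (rule cocycle_End1[OF \<omega>])
    have \<omega>': "\<omega>' \<in> space M" unfolding \<omega>'_def by (rule base_iterate_space[OF \<omega>])
    have "7 \<le> upper_envelope \<Phi> 0 - reflect (upper_envelope (reflect \<Phi>)) 0"
      using 2 by (simp add: strong_shear_def \<Phi>_def)
    moreover obtain y z where yz: "y \<in> {a..a + 2}" "z \<in> {a..a + 2}"
      "upper_envelope \<Phi> 0 - reflect (upper_envelope (reflect \<Phi>)) 0 - 1 \<le> \<Phi> y - \<Phi> z"
      using End1_real_oscillation[OF \<Phi>] by metis
    ultimately have yz6: "6 \<le> \<Phi> y - \<Phi> z" by linarith
    have less_n: "n - N < n" using N 2 by simp
    obtain P1 g1 where P1: "finite P1" "P1 \<subseteq> {\<Phi> z..\<Phi> z + 2}" "2 ^ g1 \<le> card P1"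
      "card (?S (n - N) \<omega>') \<le> (g1 + 1) * N"
      "\<And>x y. x \<in> P1 \<Longrightarrow> y \<in> P1 \<Longrightarrow> x \<noteq> y \<Longrightarrow>
        \<exists>k\<le>n - N. 1 \<le> \<bar>cocycle \<sigma> G k \<omega>' x - cocycle \<sigma> G k \<omega>' y\<bar>"
      using less.IH[OF less_n \<omega>', of "\<Phi> z"] by blast
    obtain P2 g2 where P2: "finite P2" "P2 \<subseteq> {\<Phi> z + 4..\<Phi> z + 4 + 2}" "2 ^ g2 \<le> card P2"
      "card (?S (n - N) \<omega>') \<le> (g2 + 1) * N"
      "\<And>x y. x \<in> P2 \<Longrightarrow> y \<in> P2 \<Longrightarrow> x \<noteq> y \<Longrightarrow>
        \<exists>k\<le>n - N. 1 \<le> \<bar>cocycle \<sigma> G k \<omega>' x - cocycle \<sigma> G k \<omega>' y\<bar>"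
      using less.IH[OF less_n \<omega>', of "\<Phi> z + 4"] by blast
    \<comment> \<open>The two halves may come with different exponents. The smaller one serves in
      the cardinality bound for both, and its own count of shear times is still valid.\<close>
    define g where "g = min g1 g2"
    have "P1 \<union> P2 \<subseteq> {\<Phi> z..\<Phi> y}"
      using P1(2) P2(2) yz6 by fastforce
    then obtain P where P: "P \<subseteq> {a..a + 2}" "inj_on \<Phi> P" "\<Phi> ` P = P1 \<union> P2"
      using End1_real_preimage_set[OF \<Phi> yz(2,1)] by metis
    have fin: "finite P"
      using P P1(1) P2(1) by (metis finite_UnI finite_imageD)
    have disj: "P1 \<inter> P2 = {}" using P1(2) P2(2) by fastforce
    have "(2::nat) ^ g \<le> 2 ^ g1" "(2::nat) ^ g \<le> 2 ^ g2"
      by (auto simp: g_def intro: power_increasing)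
    moreover have "2 ^ (g + 1) = 2 ^ g + (2 :: nat) ^ g" by simp
    ultimately have "2 ^ (g + 1) \<le> card P1 + card P2"
      using P1(3) P2(3) by linarith
    also have "\<dots> = card P"
      using card_image[OF P(2)] card_Un_disjoint[OF P1(1) P2(1) disj] P(3) by simp
    finally have card_P: "2 ^ (g + 1) \<le> card P" .
    \<comment> \<open>Shear times among the \<open>N\<close> skipped steps may be wasted; they
      number at most \<open>N\<close>, which the new doubling pays for.\<close>
    have "?S n \<omega> \<subseteq> {..<N} \<union> (\<lambda>l. l + N) ` ?S (n - N) \<omega>'"
    proof
      fix l assume l: "l \<in> ?S n \<omega>"
      show "l \<in> {..<N} \<union> (\<lambda>l. l + N) ` ?S (n - N) \<omega>'"
      proof (cases "l < N")
        case False
        then have eq: "l = (l - N) + N" by simp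
        have "(\<sigma> ^^ l) \<omega> = (\<sigma> ^^ (l - N)) \<omega>'"
          unfolding \<omega>'_def by (subst eq, subst funpow_add) simp
        with l False have "l - N \<in> ?S (n - N) \<omega>'" by auto
        then show ?thesis using eq by blast
      qed simp
    qed
    then have "card (?S n \<omega>) \<le> card ({..<N} \<union> (\<lambda>l. l + N) ` ?S (n - N) \<omega>')"
      by (rule card_mono[rotated]) simp
    also have "\<dots> \<le> N + card (?S (n - N) \<omega>')"
      by (intro order_trans[OF card_Un_le] add_mono card_image_le) auto
    also have "\<dots> \<le> N + (g + 1) * N"
      using P1(4) P2(4) by (auto simp: g_def min_def)
    finally have count: "card (?S n \<omega>) \<le> ((g + 1) + 1) * N" by simp
    \<comment> \<open>Images in different halves are already at distance at least 2 at time
      \<open>N\<close>; within one half the induction hypothesis separates them later.\<close>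
    have sep: "\<exists>k\<le>n. 1 \<le> \<bar>cocycle \<sigma> G k \<omega> u - cocycle \<sigma> G k \<omega> v\<bar>"
      if "u \<in> P" "v \<in> P" "u \<noteq> v" for u v
    proof -
      have ne: "\<Phi> u \<noteq> \<Phi> v" using that P(2) by (auto dest: inj_onD)
      have "\<Phi> u \<in> P1 \<union> P2" "\<Phi> v \<in> P1 \<union> P2" using that P(3) by blast+
      then consider "\<Phi> u \<in> P1" "\<Phi> v \<in> P1" | "\<Phi> u \<in> P2" "\<Phi> v \<in> P2"
        | "\<Phi> u \<in> P1" "\<Phi> v \<in> P2" | "\<Phi> u \<in> P2" "\<Phi> v \<in> P1"
        by blast
      then have "(\<exists>k\<le>n - N. 1 \<le> \<bar>cocycle \<sigma> G k \<omega>' (\<Phi> u) - cocycle \<sigma> G k \<omega>' (\<Phi> v)\<bar>)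
          \<or> 1 \<le> \<bar>\<Phi> u - \<Phi> v\<bar>"
      proof cases
        case 3
        then show ?thesis using P1(2) P2(2) by fastforce
      next
        case 4
        then show ?thesis using P1(2) P2(2) by fastforce
      qed (use P1(5) P2(5) ne in blast)+
      then show ?thesis
      proof
        assume "\<exists>k\<le>n - N. 1 \<le> \<bar>cocycle \<sigma> G k \<omega>' (\<Phi> u) - cocycle \<sigma> G k \<omega>' (\<Phi> v)\<bar>"
        then obtain k where "k \<le> n - N" "1 \<le> \<bar>cocycle \<sigma> G k \<omega>' (\<Phi> u) - cocycle \<sigma> G k \<omega>' (\<Phi> v)\<bar>"
          by blast
        then show ?thesis
          using 2 by (intro exI[of _ "k + N"]) (simp add: cocycle_add \<Phi>_def \<omega>'_def)
      next
        assume "1 \<le> \<bar>\<Phi> u - \<Phi> v\<bar>"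
        then show ?thesis using 2 by (intro exI[of _ N]) (simp add: \<Phi>_def)
      qed
    qed
    show ?thesis
      using fin P(1) card_P count sep by (intro exI[of _ P] exI[of _ "g + 1"]) blast
  next
    case 3
    have \<Phi>: "G \<omega> \<in> End1_real" by (rule End1[OF \<omega>])
    have less_n: "n - 1 < n" using N 3 by simp
    obtain Q g where Q: "finite Q" "Q \<subseteq> {G \<omega> a..G \<omega> a + 2}" "2 ^ g \<le> card Q"
      "card (?S (n - 1) (\<sigma> \<omega>)) \<le> (g + 1) * N"
      "\<And>x y. x \<in> Q \<Longrightarrow> y \<in> Q \<Longrightarrow> x \<noteq> y \<Longrightarrow>
        \<exists>k\<le>n - 1. 1 \<le> \<bar>cocycle \<sigma> G k (\<sigma> \<omega>) x - cocycle \<sigma> G k (\<sigma> \<omega>) y\<bar>"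
      using less.IH[OF less_n base_space[OF \<omega>], of "G \<omega> a"] by blast
    have "G \<omega> (a + 2) = G \<omega> a + 2"
      using End1_real_add_of_nat[OF \<Phi>, of a 2] by simp
    then obtain P where P: "P \<subseteq> {a..a + 2}" "inj_on (G \<omega>) P" "G \<omega> ` P = Q"
      using End1_real_preimage_set[OF \<Phi>, of a a "a + 2" Q] Q(2) by auto
    have fin: "finite P"
      using P Q(1) by (metis finite_imageD)
    have card_P: "2 ^ g \<le> card P" using card_image[OF P(2)] P(3) Q(3) by simp
    \<comment> \<open>Time 0 is not a shear time in this case, so moving one step loses
      none.\<close>
    have "?S n \<omega> \<subseteq> Suc ` ?S (n - 1) (\<sigma> \<omega>)"
    proof
      fix l assume l: "l \<in> ?S n \<omega>"
      with 3 obtain l' where l': "l = Suc l'" by (cases l) auto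
      then have "(\<sigma> ^^ l) \<omega> = (\<sigma> ^^ l') (\<sigma> \<omega>)" by (simp add: funpow_swap1)
      with l l' have "l' \<in> ?S (n - 1) (\<sigma> \<omega>)" by auto
      then show "l \<in> Suc ` ?S (n - 1) (\<sigma> \<omega>)" using l' by blast
    qed
    then have "card (?S n \<omega>) \<le> card (?S (n - 1) (\<sigma> \<omega>))"
      by (rule surj_card_le[rotated]) simp
    then have count: "card (?S n \<omega>) \<le> (g + 1) * N" using Q(4) by simp
    have sep: "\<exists>k\<le>n. 1 \<le> \<bar>cocycle \<sigma> G k \<omega> u - cocycle \<sigma> G k \<omega> v\<bar>"
      if "u \<in> P" "v \<in> P" "u \<noteq> v" for u v
    proof -
      have "G \<omega> u \<in> Q" "G \<omega> v \<in> Q" using that P(3) by blast+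
      moreover have "G \<omega> u \<noteq> G \<omega> v" using that P(2) by (auto dest: inj_onD)
      ultimately have "\<exists>k\<le>n - 1. 1 \<le> \<bar>cocycle \<sigma> G k (\<sigma> \<omega>) (G \<omega> u) - cocycle \<sigma> G k (\<sigma> \<omega>) (G \<omega> v)\<bar>"
        by (rule Q(5))
      then obtain k where "k \<le> n - 1"
        "1 \<le> \<bar>cocycle \<sigma> G k (\<sigma> \<omega>) (G \<omega> u) - cocycle \<sigma> G k (\<sigma> \<omega>) (G \<omega> v)\<bar>"
        by blast
      then show ?thesis
        using N 3 cocycle_add[of \<sigma> G k 1 \<omega>] by (intro exI[of _ "k + 1"]) auto
    qed
    show ?thesis
      using fin P(1) card_P count sep by (intro exI[of _ P] exI[of _ g]) blast
  qed
qed

section \<open>Lifted orbits that are close on the circle\<close>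

text \<open>Off the almost isometric fibres, \<open>4 * b \<omega> + 3\<close> bounds the number of
  integers of absolute value at most \<open>2 * b \<omega> + 1\<close>.\<close>

definition jump_count :: "real \<Rightarrow> 'a \<Rightarrow> real" where
  "jump_count e \<omega> = (if almost_isometric e (G \<omega>) then 1 else 4 * b \<omega> + 3)"

lemma b_nonneg: "\<omega> \<in> space M \<Longrightarrow> 0 \<le> b \<omega>"
  using displacement_le[of \<omega> 0] by linarith

lemma jump_count_ge_1: "\<omega> \<in> space M \<Longrightarrow> 1 \<le> jump_count e \<omega>"
  using b_nonneg[of \<omega>] by (simp add: jump_count_def)

text \<open>While two orbits stay \<open>e\<close>-close on the circle, their lifts differ by an integer up to \<open>e\<close>.
  This integer changes only where \<open>G\<close> is not almost isometric at scale \<open>e\<close>, and the change is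
  controlled by the displacement.\<close>

lemma card_shadowing_le:
  assumes \<omega>: "\<omega> \<in> space M" and e: "0 < e" "e \<le> 1 / 4"
    and Q: "finite Q" "\<And>p. p \<in> Q \<Longrightarrow> \<bar>p - q\<bar> \<le> 2"
    and close: "\<And>p k. p \<in> Q \<Longrightarrow> k \<le> n \<Longrightarrow>
      infdist (cocycle \<sigma> G k \<omega> p - cocycle \<sigma> G k \<omega> q) \<int> < e"
    and sep: "\<And>x y. x \<in> Q \<Longrightarrow> y \<in> Q \<Longrightarrow> x \<noteq> y \<Longrightarrow>
      \<exists>k\<le>n. 1 \<le> \<bar>cocycle \<sigma> G k \<omega> x - cocycle \<sigma> G k \<omega> y\<bar>"
  shows "real (card Q) \<le> 5 * (\<Prod>k<n. jump_count e ((\<sigma> ^^ k) \<omega>))"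
proof -
  define d where "d k p = cocycle \<sigma> G k \<omega> p - cocycle \<sigma> G k \<omega> q" for k p
  define m where "m k p = round (d k p)" for k p
  \<comment> \<open>The code of \<open>p\<close>: its initial integer offset from \<open>q\<close>,
    followed by the successive jumps of that offset. The set \<open>D 0\<close> has five elements
    because the points start at distance at most 2; this is the factor 5.\<close>
  define j where "j p k = (case k of 0 \<Rightarrow> m 0 p | Suc k' \<Rightarrow> m (Suc k') p - m k' p)" for p k
  define D where "D k = (case k of 0 \<Rightarrow> {-2..2 :: int} | Suc k' \<Rightarrow>
      if almost_isometric e (G ((\<sigma> ^^ k') \<omega>)) then {0}
      else {- \<lfloor>2 * b ((\<sigma> ^^ k') \<omega>) + 1\<rfloor>..\<lfloor>2 * b ((\<sigma> ^^ k') \<omega>) + 1\<rfloor>})" for k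
  have near: "\<bar>d k p - of_int (m k p)\<bar> < e" if "p \<in> Q" "k \<le> n" for k p
    using close[OF that] by (simp add: infdist_Ints_eq d_def m_def)
  have j_in: "j p k \<in> D k" if p: "p \<in> Q" and k: "k \<le> n" for p k
  proof (cases k)
    case 0
    have "\<bar>of_int (m 0 p)\<bar> < (3 :: real)"
      using near[OF p, of 0] Q(2)[OF p] e by (simp add: d_def abs_if split: if_splits)
    then have "\<bar>m 0 p\<bar> < 3" by linarith
    then show ?thesis using 0 by (auto simp: j_def D_def)
  next
    case (Suc k')
    define g where "g = G ((\<sigma> ^^ k') \<omega>)"
    define u where "u = cocycle \<sigma> G k' \<omega> p"
    define v where "v = cocycle \<sigma> G k' \<omega> q"
    \<comment> \<open>The integer translate of the orbit of \<open>p\<close> that is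
      \<open>e\<close>-close to the orbit of \<open>q\<close> on the line.\<close>
    define w where "w = u - of_int (m k' p)"
    have space: "(\<sigma> ^^ k') \<omega> \<in> space M" by (rule base_iterate_space[OF \<omega>])
    have wv: "\<bar>w - v\<bar> < e"
      using near[OF p, of k'] k Suc by (simp add: w_def d_def u_def v_def algebra_simps)
    have "g u = g w + of_int (m k' p)"
      using End1_real_add_of_int[OF End1[OF space], of w "m k' p"] by (simp add: g_def w_def)
    moreover have "d (Suc k') p = g u - g v"
      by (simp add: d_def g_def u_def v_def)
    ultimately have jump: "\<bar>g w - g v - of_int (j p k)\<bar> < e"
      using near[OF p k] Suc by (simp add: j_def algebra_simps)
    show ?thesis
    proof (cases "almost_isometric e g")
      case True
      then have "\<bar>g w - g v\<bar> \<le> 1 / 2" using wv by (auto simp: almost_isometric_def)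
      then have "\<bar>of_int (j p k)\<bar> < (1 :: real)" using jump e by linarith
      then have "j p k = 0" by linarith
      then show ?thesis using True Suc by (simp add: D_def g_def)
    next
      case False
      have "\<bar>g w - w\<bar> \<le> b ((\<sigma> ^^ k') \<omega>)" "\<bar>g v - v\<bar> \<le> b ((\<sigma> ^^ k') \<omega>)"
        unfolding g_def by (rule displacement_le[OF space])+
      \<comment> \<open>The displacements contribute \<open>2 * b\<close>, and the distance of
        \<open>w\<close> and \<open>v\<close> together with the rounding error less than
        \<open>2 * e \<le> 1 / 2\<close>.\<close>
      then have "\<bar>of_int (j p k)\<bar> \<le> 2 * b ((\<sigma> ^^ k') \<omega>) + 1"
        using jump wv e by linarith
      then have "\<bar>j p k\<bar> \<le> \<lfloor>2 * b ((\<sigma> ^^ k') \<omega>) + 1\<rfloor>"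
        by (simp only: le_floor_iff of_int_abs)
      then show ?thesis using False Suc by (auto simp: D_def g_def)
    qed
  qed
  \<comment> \<open>Equal codes give equal offsets at all times, so the two lifts stay within
    \<open>2 * e < 1\<close> of each other, against their separation.\<close>
  have inj: "inj_on (\<lambda>p. restrict (j p) {..n}) Q"
  proof (rule inj_onI, rule ccontr)
    fix x y assume xy: "x \<in> Q" "y \<in> Q" "x \<noteq> y"
      and eq: "restrict (j x) {..n} = restrict (j y) {..n}"
    have j_eq: "j x k = j y k" if "k \<le> n" for k
      using fun_cong[OF eq, of k] that by simp
    have m_eq: "m k x = m k y" if "k \<le> n" for k
      using that
    proof (induction k)
      case 0
      then show ?case using j_eq[of 0] by (simp add: j_def)
    next
      case (Suc k)
      then show ?case using j_eq[of "Suc k"] by (simp add: j_def)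
    qed
    obtain k where k: "k \<le> n" "1 \<le> \<bar>cocycle \<sigma> G k \<omega> x - cocycle \<sigma> G k \<omega> y\<bar>"
      using sep[OF xy] by blast
    then have "1 \<le> \<bar>d k x - d k y\<bar>" by (simp add: d_def)
    then show False
      using near[OF xy(1) k(1)] near[OF xy(2) k(1)] m_eq[OF k(1)] e by linarith
  qed
  have fin_D: "finite (D k)" for k by (auto simp: D_def split: nat.split)
  have "(\<lambda>p. restrict (j p) {..n}) ` Q \<subseteq> PiE {..n} D"
    by (intro image_subsetI) (simp add: restrict_PiE_iff j_in)
  then have "card Q \<le> card (PiE {..n} D)"
    using fin_D by (intro card_inj_on_le[OF inj] finite_PiE) auto
  also have "\<dots> = card (D 0) * (\<Prod>k<n. card (D (Suc k)))"
    by (simp add: card_PiE prod.atMost_shift)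
  finally have "real (card Q) \<le> real (card (D 0)) * (\<Prod>k<n. real (card (D (Suc k))))"
    by (simp flip: of_nat_prod of_nat_mult)
  also have "\<dots> \<le> 5 * (\<Prod>k<n. jump_count e ((\<sigma> ^^ k) \<omega>))"
  proof -
    have "real (card (D (Suc k))) \<le> jump_count e ((\<sigma> ^^ k) \<omega>)" for k
    proof (cases "almost_isometric e (G ((\<sigma> ^^ k) \<omega>))")
      case True
      then show ?thesis by (simp add: D_def jump_count_def)
    next
      case False
      define B where "B = b ((\<sigma> ^^ k) \<omega>)"
      have "0 \<le> B" unfolding B_def by (intro b_nonneg base_iterate_space \<omega>)
      then have "real (card {- \<lfloor>2 * B + 1\<rfloor>..\<lfloor>2 * B + 1\<rfloor>}) = of_int (2 * \<lfloor>2 * B + 1\<rfloor> + 1)"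
        by simp
      also have "\<dots> \<le> 4 * B + 3"
        using of_int_floor_le[of "2 * B + 1"] by (simp del: of_int_floor_le)
      finally show ?thesis using False by (simp add: D_def jump_count_def B_def)
    qed
    then show ?thesis
      by (intro mult_mono prod_mono prod_nonneg) (auto simp: D_def[of 0])
  qed
  finally show ?thesis .
qed

end

section \<open>Random topological entropy\<close>

text \<open>The shift is needed because the times 0 to n are seen by the Bowen distance of order
  \<open>Suc n\<close>.\<close>

lemma LIMSEQ_imp_limsup_ge_shifted:
  fixes u v :: "nat \<Rightarrow> real"
  assumes "u \<longlonglongrightarrow> L" and "\<And>n. u n \<le> v (Suc n)"
  shows "ereal L \<le> limsup (\<lambda>n. ereal (v n))"
proof -
  have "ereal L = limsup (\<lambda>n. ereal (u n))"
    using assms(1) by (intro lim_imp_Limsup[symmetric]) auto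
  also have "\<dots> \<le> limsup (\<lambda>n. ereal (v (n + 1)))"
    using assms(2) by (intro Limsup_mono) auto
  also have "\<dots> = limsup (\<lambda>n. ereal (v n))"
    by (rule limsup_shift)
  finally show ?thesis .
qed

locale circle_cocycle_with_lift = integrable_degree_one_cocycle +
  fixes f :: "'a \<Rightarrow> circle \<Rightarrow> circle"
  assumes semiconjugacy: "\<omega> \<in> space M \<Longrightarrow> f \<omega> (proj x) = proj (G \<omega> x)"
begin

lemma cocycle_proj: "\<omega> \<in> space M \<Longrightarrow> cocycle \<sigma> f n \<omega> (proj x) = proj (cocycle \<sigma> G n \<omega> x)"
  by (induction n) (simp_all add: semiconjugacy base_iterate_space)

lemma le_bowen_dist_proj_iff:
  assumes "\<omega> \<in> space M" "0 < n"
  shows "e \<le> bowen_dist \<sigma> f \<omega> n (proj x) (proj y) \<longleftrightarrow>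
    (\<exists>k<n. e \<le> infdist (cocycle \<sigma> G k \<omega> x - cocycle \<sigma> G k \<omega> y) \<int>)"
  using assms by (simp add: le_bowen_dist_iff cocycle_proj dist_proj)

lemma cocycle_uniformly_continuous:
  assumes \<omega>: "\<omega> \<in> space M" and "0 < e"
  shows "\<exists>d>0. \<forall>x y. \<bar>x - y\<bar> < d \<longrightarrow> (\<forall>k<n. \<bar>cocycle \<sigma> G k \<omega> x - cocycle \<sigma> G k \<omega> y\<bar> < e)"
proof (induction n)
  case 0
  show ?case by (intro exI[of _ 1]) simp
next
  case (Suc n)
  then obtain d where d: "0 < d"
    "\<And>x y k. \<bar>x - y\<bar> < d \<Longrightarrow> k < n \<Longrightarrow> \<bar>cocycle \<sigma> G k \<omega> x - cocycle \<sigma> G k \<omega> y\<bar> < e"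
    by blast
  obtain d' where d': "0 < d'"
    "\<And>x y. \<bar>x - y\<bar> < d' \<Longrightarrow> \<bar>cocycle \<sigma> G n \<omega> x - cocycle \<sigma> G n \<omega> y\<bar> < e"
    using End1_real_uniformly_continuous[OF cocycle_End1[OF \<omega>] \<open>0 < e\<close>] by metis
  show ?case
    using d d' by (intro exI[of _ "min d d'"]) (auto simp: less_Suc_eq simp del: cocycle.simps)
qed

text \<open>Pigeonhole on the unit interval: points with representatives in one cell of length
  \<open>1 / real (Suc N)\<close> stay \<open>e\<close>-close for \<open>n\<close> steps.\<close>

lemma card_separated_bounded:
  assumes \<omega>: "\<omega> \<in> space M" and "0 < e" "0 < n"
  obtains B where "\<And>E. finite E \<Longrightarrow> separated \<sigma> f n e \<omega> E \<Longrightarrow> card E \<le> B"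
proof -
  obtain d where d: "0 < d"
    "\<And>x y k. \<bar>x - y\<bar> < d \<Longrightarrow> k < n \<Longrightarrow> \<bar>cocycle \<sigma> G k \<omega> x - cocycle \<sigma> G k \<omega> y\<bar> < e"
    using cocycle_uniformly_continuous[OF \<omega> \<open>0 < e\<close>] by blast
  obtain N where N: "1 / real (Suc N) < d" using nat_approx_posE[OF d(1)] .
  obtain r where r: "\<And>p. r p \<in> {0..<1}" "\<And>p. p = proj (r p)"
    using proj_surj_unit by metis
  define cell where "cell p = \<lfloor>r p * real (Suc N)\<rfloor>" for p
  have "card E \<le> card {0..<int (Suc N)}" if E: "finite E" "separated \<sigma> f n e \<omega> E" for E
  proof (rule card_inj_on_le)
    show "cell ` E \<subseteq> {0..<int (Suc N)}"
    proof (intro image_subsetI)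
      fix p
      have "0 \<le> r p" "r p < 1" using r(1)[of p] by auto
      then have "0 \<le> r p * real (Suc N)" "r p * real (Suc N) < 1 * real (Suc N)"
        by (auto intro!: mult_strict_right_mono simp del: of_nat_Suc)
      then show "cell p \<in> {0..<int (Suc N)}"
        unfolding cell_def by (auto simp: floor_less_iff simp del: of_nat_Suc)
    qed
    show "inj_on cell E"
    proof (rule inj_onI, rule ccontr)
      fix p q assume pq: "p \<in> E" "q \<in> E" "p \<noteq> q" and eq: "cell p = cell q"
      have "\<bar>r p * real (Suc N) - r q * real (Suc N)\<bar> < 1"
        using eq unfolding cell_def by linarith
      then have "\<bar>r p - r q\<bar> * real (Suc N) < 1"
        by (simp add: abs_mult left_diff_distrib[symmetric] del: of_nat_Suc)
      then have "\<bar>r p - r q\<bar> < 1 / real (Suc N)"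
        by (simp add: less_divide_eq del: of_nat_Suc)
      with N have "\<bar>r p - r q\<bar> < d" by linarith
      moreover have "e \<le> bowen_dist \<sigma> f \<omega> n (proj (r p)) (proj (r q))"
        using E(2) pq r(2) unfolding separated_def by metis
      ultimately show False
        using d(2) infdist_Ints_le_abs
        unfolding le_bowen_dist_proj_iff[OF \<omega> \<open>0 < n\<close>] by (meson le_less_trans not_less)
    qed
  qed simp
  then show ?thesis by (rule that)
qed

lemma
  assumes \<omega>: "\<omega> \<in> space M" and e: "0 < e" and n: "0 < n"
  shows card_le_max_separated:
      "\<And>E. finite E \<Longrightarrow> separated \<sigma> f n e \<omega> E \<Longrightarrow> card E \<le> max_separated \<sigma> f n e \<omega>"
    and max_separated_attained:
      "\<exists>E. finite E \<and> separated \<sigma> f n e \<omega> E \<and> card E = max_separated \<sigma> f n e \<omega>"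
    and max_separated_pos: "1 \<le> max_separated \<sigma> f n e \<omega>"
proof -
  let ?C = "{card E | E. finite E \<and> separated \<sigma> f n e \<omega> E}"
  obtain B where "\<And>E. finite E \<Longrightarrow> separated \<sigma> f n e \<omega> E \<Longrightarrow> card E \<le> B"
    using card_separated_bounded[OF \<omega> e n] by blast
  then have "?C \<subseteq> {..B}" by auto
  then have fin: "finite ?C" by (rule finite_subset) simp
  show le: "card E \<le> max_separated \<sigma> f n e \<omega>" if "finite E" "separated \<sigma> f n e \<omega> E" for E
    unfolding max_separated_def using that by (intro Max_ge fin) blast
  have "separated \<sigma> f n e \<omega> {}" by (simp add: separated_def)
  then have "?C \<noteq> {}" by blast
  then show "\<exists>E. finite E \<and> separated \<sigma> f n e \<omega> E \<and> card E = max_separated \<sigma> f n e \<omega>"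
    using Max_in[OF fin] unfolding max_separated_def by auto
  show "1 \<le> max_separated \<sigma> f n e \<omega>"
    using le[of "{undefined}"] by (simp add: separated_def)
qed

text \<open>For a maximal separated subset \<open>E\<close> of the projection of \<open>P\<close>,
  the Bowen balls around \<open>E\<close> cover \<open>P\<close>. Each ball contains few points of
  \<open>P\<close> by the shadowing count.\<close>

lemma card_separated_lifts_le:
  assumes \<omega>: "\<omega> \<in> space M" and e: "0 < e" "e \<le> 1 / 4"
    and P: "finite P" "P \<subseteq> {a..a + 2}"
    and sep: "\<And>x y. x \<in> P \<Longrightarrow> y \<in> P \<Longrightarrow> x \<noteq> y \<Longrightarrow>
      \<exists>k\<le>n. 1 \<le> \<bar>cocycle \<sigma> G k \<omega> x - cocycle \<sigma> G k \<omega> y\<bar>"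
  shows "real (card P) \<le>
    real (max_separated \<sigma> f (Suc n) e \<omega>) * (5 * (\<Prod>k<n. jump_count e ((\<sigma> ^^ k) \<omega>)))"
proof -
  let ?J = "5 * (\<Prod>k<n. jump_count e ((\<sigma> ^^ k) \<omega>))"
  define C where "C = {E \<in> Pow (proj ` P). separated \<sigma> f (Suc n) e \<omega> E}"
  have "{} \<in> C" by (simp add: C_def separated_def)
  moreover have "finite C" using P(1) by (simp add: C_def)
  ultimately obtain E where E: "E \<in> C" "\<And>E'. E' \<in> C \<Longrightarrow> E \<subseteq> E' \<Longrightarrow> E' = E"
    using finite_has_maximal[of C] by auto
  have E_sub: "E \<subseteq> proj ` P" and E_sep: "separated \<sigma> f (Suc n) e \<omega> E"
    using E(1) by (auto simp: C_def)
  have fin_E: "finite E" using E_sub P(1) by (meson finite_imageI finite_subset)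
  have "\<forall>x\<in>E. \<exists>p. p \<in> P \<and> x = proj p" using E_sub by blast
  from bchoice[OF this] obtain r where
    r: "\<And>x. x \<in> E \<Longrightarrow> r x \<in> P" "\<And>x. x \<in> E \<Longrightarrow> x = proj (r x)"
    by blast
  define Q where "Q x = {p \<in> P. \<forall>k\<le>n.
    infdist (cocycle \<sigma> G k \<omega> p - cocycle \<sigma> G k \<omega> (r x)) \<int> < e}" for x
  have Q_iff: "p \<in> Q x \<longleftrightarrow> p \<in> P \<and> \<not> e \<le> bowen_dist \<sigma> f \<omega> (Suc n) (proj p) x" if "x \<in> E" for p x
  proof -
    have "\<not> e \<le> bowen_dist \<sigma> f \<omega> (Suc n) (proj p) x \<longleftrightarrow>
        (\<forall>k\<le>n. infdist (cocycle \<sigma> G k \<omega> p - cocycle \<sigma> G k \<omega> (r x)) \<int> < e)"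
      using le_bowen_dist_proj_iff[OF \<omega>, of "Suc n" e p "r x"] r(2)[OF that, symmetric]
      by (simp only: less_Suc_eq_le) (meson not_le zero_less_Suc)
    then show ?thesis unfolding Q_def by blast
  qed
  have sym: "bowen_dist \<sigma> f \<omega> m x y = bowen_dist \<sigma> f \<omega> m y x" for m x y
    by (simp add: bowen_dist_def dist_commute)
  have "P \<subseteq> (\<Union>x\<in>E. Q x)"
  proof
    fix p assume p: "p \<in> P"
    show "p \<in> (\<Union>x\<in>E. Q x)"
    proof (rule ccontr)
      assume *: "p \<notin> (\<Union>x\<in>E. Q x)"
      then have far: "e \<le> bowen_dist \<sigma> f \<omega> (Suc n) (proj p) x" if "x \<in> E" for x
        using Q_iff p that by blast
      \<comment> \<open>By maximality the added point was already in \<open>E\<close>, which is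
        absurd since its Bowen distance to itself is 0.\<close>
      then have "separated \<sigma> f (Suc n) e \<omega> (insert (proj p) E)"
        using E_sep sym unfolding separated_def by (metis insertE)
      then have "insert (proj p) E = E"
        using E_sub p by (intro E(2)) (auto simp: C_def)
      then have "proj p \<in> E" by blast
      then have "e \<le> bowen_dist \<sigma> f \<omega> (Suc n) (proj p) (proj p)" by (rule far)
      then show False using e by (simp add: le_bowen_dist_iff)
    qed
  qed
  then have "card P \<le> card (\<Union>x\<in>E. Q x)"
    using fin_E P(1) by (intro card_mono) (auto simp: Q_def)
  also have "\<dots> \<le> (\<Sum>x\<in>E. card (Q x))" by (rule card_UN_le[OF fin_E])
  finally have "real (card P) \<le> (\<Sum>x\<in>E. real (card (Q x)))" by (simp flip: of_nat_sum)
  also have "\<dots> \<le> (\<Sum>x\<in>E. ?J)"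
  proof (rule sum_mono)
    fix x assume x: "x \<in> E"
    show "real (card (Q x)) \<le> ?J"
    proof (rule card_shadowing_le[OF \<omega> e, where q = "r x"])
      show "finite (Q x)" using P(1) by (simp add: Q_def)
      show "\<bar>p - r x\<bar> \<le> 2" if "p \<in> Q x" for p
      proof -
        have "p \<in> {a..a + 2}" "r x \<in> {a..a + 2}"
          using that r(1)[OF x] P(2) unfolding Q_def by blast+
        then show ?thesis by simp linarith
      qed
    qed (use sep in \<open>auto simp: Q_def\<close>)
  qed
  also have "\<dots> = real (card E) * ?J" by simp
  also have "\<dots> \<le> real (max_separated \<sigma> f (Suc n) e \<omega>) * ?J"
  proof (rule mult_right_mono)
    show "real (card E) \<le> real (max_separated \<sigma> f (Suc n) e \<omega>)"
      using card_le_max_separated[OF \<omega> e(1) _ fin_E E_sep] by simp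
    have "0 \<le> jump_count e ((\<sigma> ^^ k) \<omega>)" for k
      using jump_count_ge_1[OF base_iterate_space[OF \<omega>], of e k] by linarith
    then show "0 \<le> ?J" by (simp add: prod_nonneg)
  qed
  finally show ?thesis .
qed

lemma entropy_at_scale_antimono:
  assumes \<omega>: "\<omega> \<in> space M" and e: "0 < e" "e \<le> e'"
  shows "entropy_at_scale \<sigma> f e' \<omega> \<le> entropy_at_scale \<sigma> f e \<omega>"
  unfolding entropy_at_scale_def
proof (rule Limsup_mono, rule eventually_mono[OF eventually_gt_at_top[of 0]])
  fix n :: nat assume n: "0 < n"
  have e': "0 < e'" using e by simp
  obtain E where E: "finite E" "separated \<sigma> f n e' \<omega> E" "card E = max_separated \<sigma> f n e' \<omega>"
    using max_separated_attained[OF \<omega> e' n] by blast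
  from E(2) e have "separated \<sigma> f n e \<omega> E" unfolding separated_def by fastforce
  with E have "max_separated \<sigma> f n e' \<omega> \<le> max_separated \<sigma> f n e \<omega>"
    using card_le_max_separated[OF \<omega> e(1) n] by metis
  then show "ereal (ln (real (max_separated \<sigma> f n e' \<omega>)) / real n)
      \<le> ereal (ln (real (max_separated \<sigma> f n e \<omega>)) / real n)"
    using max_separated_pos[OF \<omega> e' n] n by (auto intro!: divide_right_mono)
qed

section \<open>The limit over small scales and its almost sure value\<close>

text \<open>A countable supremum is used for the sake of measurability; monotonicity in the scale
  identifies it with the limit at 0.\<close>

definition entropy_limit :: "'a \<Rightarrow> ereal" where
  "entropy_limit \<omega> = (SUP j. entropy_at_scale \<sigma> f (1 / real (Suc j)) \<omega>)"

lemma entropy_at_scale_le_limit: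
  assumes \<omega>: "\<omega> \<in> space M" and "0 < e"
  shows "entropy_at_scale \<sigma> f e \<omega> \<le> entropy_limit \<omega>"
proof -
  obtain j where "1 / real (Suc j) < e" using nat_approx_posE[OF \<open>0 < e\<close>] .
  then have "entropy_at_scale \<sigma> f e \<omega> \<le> entropy_at_scale \<sigma> f (1 / real (Suc j)) \<omega>"
    by (intro entropy_at_scale_antimono[OF \<omega>]) auto
  also have "\<dots> \<le> entropy_limit \<omega>" unfolding entropy_limit_def by (rule SUP_upper) simp
  finally show ?thesis .
qed

lemma entropy_at_scale_tendsto_limit:
  assumes \<omega>: "\<omega> \<in> space M"
  shows "((\<lambda>e. entropy_at_scale \<sigma> f e \<omega>) \<longlongrightarrow> entropy_limit \<omega>) (at_right 0)"
proof (rule order_tendstoI)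
  fix h assume "h < entropy_limit \<omega>"
  then obtain j where j: "h < entropy_at_scale \<sigma> f (1 / real (Suc j)) \<omega>"
    unfolding entropy_limit_def less_SUP_iff by blast
  have "\<forall>\<^sub>F e in at_right 0. e \<in> {0<..<1 / real (Suc j)}"
    by (rule eventually_at_right_real) simp
  then show "\<forall>\<^sub>F e in at_right 0. h < entropy_at_scale \<sigma> f e \<omega>"
  proof eventually_elim
    case (elim e)
    then have "entropy_at_scale \<sigma> f (1 / real (Suc j)) \<omega> \<le> entropy_at_scale \<sigma> f e \<omega>"
      by (intro entropy_at_scale_antimono[OF \<omega>]) auto
    with j show ?case by (rule less_le_trans)
  qed
next
  fix h assume h: "entropy_limit \<omega> < h"
  show "\<forall>\<^sub>F e in at_right 0. entropy_at_scale \<sigma> f e \<omega> < h"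
    using eventually_at_right_less[of "0 :: real"]
    by eventually_elim (use h entropy_at_scale_le_limit[OF \<omega>] in \<open>blast intro: le_less_trans\<close>)
qed

text \<open>Surjectivity of \<open>f \<omega>\<close> lifts separated sets from the fibre over \<open>\<sigma> \<omega>\<close> to the one over \<open>\<omega>\<close>.\<close>

lemma max_separated_base_le:
  assumes \<omega>: "\<omega> \<in> space M" and e: "0 < e" and n: "0 < n"
  shows "max_separated \<sigma> f n e (\<sigma> \<omega>) \<le> max_separated \<sigma> f (Suc n) e \<omega>"
proof -
  obtain E where E: "finite E" "separated \<sigma> f n e (\<sigma> \<omega>) E" "card E = max_separated \<sigma> f n e (\<sigma> \<omega>)"
    using max_separated_attained[OF base_space[OF \<omega>] e n] by blast
  have "\<exists>q. f \<omega> q = p" for p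
  proof -
    obtain x where "p = proj x" using proj_surj_unit by blast
    moreover obtain y where "G \<omega> y = x" using End1_real_surj[OF End1[OF \<omega>]] by blast
    ultimately show ?thesis using semiconjugacy[OF \<omega>] by metis
  qed
  then obtain g where g: "\<And>p. f \<omega> (g p) = p" by metis
  have inj: "inj_on g E" by (metis g inj_onI)
  have "separated \<sigma> f (Suc n) e \<omega> (g ` E)"
    unfolding separated_def
  proof (intro ballI impI)
    fix x y assume xy: "x \<in> g ` E" "y \<in> g ` E" "x \<noteq> y"
    then obtain p q where pq: "p \<in> E" "q \<in> E" "x = g p" "y = g q" by blast
    with xy(3) have "p \<noteq> q" by blast
    then have "e \<le> bowen_dist \<sigma> f (\<sigma> \<omega>) n p q" using E(2) pq by (simp add: separated_def)
    then obtain k where k: "k < n"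
      "e \<le> dist (cocycle \<sigma> f k (\<sigma> \<omega>) p) (cocycle \<sigma> f k (\<sigma> \<omega>) q)"
      unfolding le_bowen_dist_iff[OF n] by blast
    then have "e \<le> dist (cocycle \<sigma> f (k + 1) \<omega> x) (cocycle \<sigma> f (k + 1) \<omega> y)"
      unfolding cocycle_add by (simp add: pq g)
    with k(1) show "e \<le> bowen_dist \<sigma> f \<omega> (Suc n) x y"
      unfolding le_bowen_dist_iff[OF zero_less_Suc] by (intro exI[of _ "k + 1"]) simp
  qed
  then have "card (g ` E) \<le> max_separated \<sigma> f (Suc n) e \<omega>"
    using E(1) by (intro card_le_max_separated[OF \<omega> e]) auto
  then show ?thesis using card_image[OF inj] E(3) by simp
qed

text \<open>The extra time step in the comparison of separated sets only changes the divisor, and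
  \<open>Suc n / n\<close> tends to 1.\<close>

lemma entropy_at_scale_base_le:
  assumes \<omega>: "\<omega> \<in> space M" and e: "0 < e"
  shows "entropy_at_scale \<sigma> f e (\<sigma> \<omega>) \<le> entropy_at_scale \<sigma> f e \<omega>"
proof -
  define v where "v n = ereal (ln (real (max_separated \<sigma> f n e \<omega>)) / real n)" for n
  have "entropy_at_scale \<sigma> f e (\<sigma> \<omega>) \<le> limsup (\<lambda>n. ereal (real (Suc n) / real n) * v (n + 1))"
    unfolding entropy_at_scale_def
  proof (rule Limsup_mono, rule eventually_mono[OF eventually_gt_at_top[of 0]])
    fix n :: nat assume n: "0 < n"
    have "ln (real (max_separated \<sigma> f n e (\<sigma> \<omega>))) \<le> ln (real (max_separated \<sigma> f (Suc n) e \<omega>))"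
      using max_separated_base_le[OF \<omega> e n] max_separated_pos[OF base_space[OF \<omega>] e n] by simp
    then show "ereal (ln (real (max_separated \<sigma> f n e (\<sigma> \<omega>))) / real n)
        \<le> ereal (real (Suc n) / real n) * v (n + 1)"
      using n by (simp add: v_def divide_right_mono del: of_nat_Suc)
  qed
  also have "\<dots> = 1 * limsup (\<lambda>n. v (n + 1))"
  proof (rule ereal_limsup_lim_mult)
    have "(\<lambda>n. real (Suc n) / real n) \<longlonglongrightarrow> 1" by real_asymp
    then show "(\<lambda>n. ereal (real (Suc n) / real n)) \<longlonglongrightarrow> 1"
      by (simp add: one_ereal_def)
  qed auto
  also have "\<dots> = entropy_at_scale \<sigma> f e \<omega>"
    unfolding mult_1 limsup_shift by (simp add: v_def[abs_def] entropy_at_scale_def)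
  finally show ?thesis .
qed

lemma entropy_limit_base_le:
  assumes "\<omega> \<in> space M"
  shows "entropy_limit (\<sigma> \<omega>) \<le> entropy_limit \<omega>"
  unfolding entropy_limit_def
  by (intro SUP_mono' entropy_at_scale_base_le assms) simp

text \<open>Separated sets of rational points, with a strict inequality: a countable and hence measurable
  substitute for \<^const>\<open>max_separated\<close>.\<close>

definition rationally_separated :: "nat \<Rightarrow> real \<Rightarrow> 'a \<Rightarrow> real set \<Rightarrow> bool" where
  "rationally_separated n e \<omega> E \<longleftrightarrow> (\<forall>x\<in>E. \<forall>y\<in>E. x \<noteq> y \<longrightarrow>
     (\<exists>k<n. e < infdist (cocycle \<sigma> G k \<omega> x - cocycle \<sigma> G k \<omega> y) \<int>))"

text \<open>The default value 0 is harmless: \<open>max_separated\<close> is at least 1, so the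
  quantity to be approximated is never negative.\<close>

definition rational_growth :: "nat \<Rightarrow> real \<Rightarrow> 'a \<Rightarrow> ereal" where
  "rational_growth n e \<omega> = (SUP E\<in>{E. E \<subseteq> \<rat> \<and> finite E}.
     ereal (if rationally_separated n e \<omega> E then ln (real (card E)) / real n else 0))"

lemma rational_growth_measurable: "rational_growth n e \<in> borel_measurable M"
proof -
  have "{\<omega> \<in> space M. rationally_separated n e \<omega> E} \<in> sets M"
    if "E \<subseteq> \<rat>" "finite E" for E
  proof -
    have [measurable]: "(\<lambda>\<omega>. infdist (cocycle \<sigma> G k \<omega> x - cocycle \<sigma> G k \<omega> y) \<int>) \<in> borel_measurable M"
      for k x y
      by (rule measurable_compose[OF _ borel_measurable_continuous_onI[of "\<lambda>x. infdist x \<int>"]])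
        (measurable, intro continuous_intros)
    have [simp]: "countable E" using \<open>finite E\<close> by (rule countable_finite)
    show ?thesis unfolding rationally_separated_def by measurable
  qed
  moreover have "countable {E :: real set. E \<subseteq> \<rat> \<and> finite E}"
    using countable_Collect_finite_subset[OF countable_rat] by (simp add: conj_commute)
  ultimately show ?thesis
    unfolding rational_growth_def[abs_def] by (intro borel_measurable_SUP) auto
qed

lemma rational_growth_le:
  assumes \<omega>: "\<omega> \<in> space M" and e: "0 < e" and n: "0 < n"
  shows "rational_growth n e \<omega> \<le> ereal (ln (real (max_separated \<sigma> f n e \<omega>)) / real n)"
  unfolding rational_growth_def
proof (rule SUP_least)
  fix E :: "real set" assume "E \<in> {E. E \<subseteq> \<rat> \<and> finite E}"
  then have fin: "finite E" by simp
  have "ln (real (card E)) \<le> ln (real (max_separated \<sigma> f n e \<omega>))" if E: "rationally_separated n e \<omega> E"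
  proof -
    have sep: "e \<le> bowen_dist \<sigma> f \<omega> n (proj x) (proj y)" if "x \<in> E" "y \<in> E" "x \<noteq> y" for x y
      using E that unfolding le_bowen_dist_proj_iff[OF \<omega> n] rationally_separated_def
      by (meson less_imp_le)
    have inj: "inj_on proj E"
    proof (rule inj_onI, rule ccontr)
      fix x y assume xy: "x \<in> E" "y \<in> E" "x \<noteq> y" and eq: "proj x = proj y"
      have "e \<le> bowen_dist \<sigma> f \<omega> n (proj y) (proj y)" using sep[OF xy] eq by simp
      then show False using e unfolding le_bowen_dist_iff[OF n] by simp
    qed
    have "card (proj ` E) \<le> max_separated \<sigma> f n e \<omega>"
      using fin sep by (intro card_le_max_separated[OF \<omega> e n]) (auto simp: separated_def)
    then have "card E \<le> max_separated \<sigma> f n e \<omega>" by (simp add: card_image[OF inj])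
    then show ?thesis
      using max_separated_pos[OF \<omega> e n] by (cases "card E = 0") auto
  qed
  then show "ereal (if rationally_separated n e \<omega> E then ln (real (card E)) / real n else 0)
      \<le> ereal (ln (real (max_separated \<sigma> f n e \<omega>)) / real n)"
    using max_separated_pos[OF \<omega> e n] n by (auto intro!: divide_right_mono)
qed

text \<open>The points of an optimal set at scale \<open>e'\<close> are moved to nearby rationals.
  Each of the two orbits changes by less than \<open>(e' - e) / 2\<close> over \<open>n\<close>
  steps, so the separation stays above \<open>e\<close>.\<close>

lemma rational_growth_ge:
  assumes \<omega>: "\<omega> \<in> space M" and e: "0 < e" "e < e'" and n: "0 < n"
  shows "ereal (ln (real (max_separated \<sigma> f n e' \<omega>)) / real n) \<le> rational_growth n e \<omega>"
proof -
  have e': "0 < e'" using e by simp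
  obtain E where E: "finite E" "separated \<sigma> f n e' \<omega> E" "card E = max_separated \<sigma> f n e' \<omega>"
    using max_separated_attained[OF \<omega> e' n] by blast
  have "0 < (e' - e) / 2" using e by simp
  then obtain d where d: "0 < d" "\<And>x y k. \<bar>x - y\<bar> < d \<Longrightarrow> k < n \<Longrightarrow>
      \<bar>cocycle \<sigma> G k \<omega> x - cocycle \<sigma> G k \<omega> y\<bar> < (e' - e) / 2"
    using cocycle_uniformly_continuous[OF \<omega>] by blast
  have "\<exists>x q. p = proj x \<and> q \<in> \<rat> \<and> \<bar>x - q\<bar> < d" for p
  proof -
    obtain x where "p = proj x" using proj_surj_unit by blast
    moreover obtain q where "q \<in> \<rat>" "x < q" "q < x + d"
      using Rats_dense_in_real[of x "x + d"] d(1) by auto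
    ultimately show ?thesis by (intro exI[of _ x] exI[of _ q]) auto
  qed
  then obtain r q where r: "\<And>p. p = proj (r p)" and q: "\<And>p. q p \<in> \<rat>" "\<And>p. \<bar>r p - q p\<bar> < d"
    by metis
  have sep: "\<exists>k<n. e < infdist (cocycle \<sigma> G k \<omega> (q x) - cocycle \<sigma> G k \<omega> (q y)) \<int>"
    if xy: "x \<in> E" "y \<in> E" "x \<noteq> y" for x y
  proof -
    have "e' \<le> bowen_dist \<sigma> f \<omega> n (proj (r x)) (proj (r y))"
      using E(2) xy r unfolding separated_def by metis
    then obtain k where k: "k < n"
      "e' \<le> infdist (cocycle \<sigma> G k \<omega> (r x) - cocycle \<sigma> G k \<omega> (r y)) \<int>"
      unfolding le_bowen_dist_proj_iff[OF \<omega> n] by blast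
    let ?c = "cocycle \<sigma> G k \<omega>"
    have "infdist (?c (r x) - ?c (r y)) \<int> \<le> infdist (?c (q x) - ?c (q y)) \<int>
        + dist (?c (r x) - ?c (r y)) (?c (q x) - ?c (q y))"
      by (rule infdist_triangle)
    moreover have "dist (?c (r x) - ?c (r y)) (?c (q x) - ?c (q y)) < e' - e"
    proof -
      have "\<bar>a - b - (a' - b')\<bar> < e' - e"
        if "\<bar>a - a'\<bar> < (e' - e) / 2" "\<bar>b - b'\<bar> < (e' - e) / 2" for a a' b b' :: real
      proof -
        have "\<bar>a - b - (a' - b')\<bar> \<le> \<bar>a - a'\<bar> + \<bar>b - b'\<bar>"
          using abs_triangle_ineq4[of "a - a'" "b - b'"] by (simp add: algebra_simps)
        also have "\<dots> < (e' - e) / 2 + (e' - e) / 2" using that by (rule add_strict_mono)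
        finally show ?thesis by simp
      qed
      then show ?thesis
        using d(2)[OF q(2)[of x] k(1)] d(2)[OF q(2)[of y] k(1)] unfolding dist_real_def by blast
    qed
    ultimately show ?thesis using k by (intro exI[of _ k]) auto
  qed
  have inj: "inj_on q E"
  proof (rule inj_onI, rule ccontr)
    fix x y assume "x \<in> E" "y \<in> E" "x \<noteq> y" "q x = q y"
    then show False using sep[of x y] e(1) by (auto simp: Ints_0)
  qed
  have "rationally_separated n e \<omega> (q ` E)"
    using sep unfolding rationally_separated_def by blast
  then have "ereal (ln (real (max_separated \<sigma> f n e' \<omega>)) / real n) =
      ereal (if rationally_separated n e \<omega> (q ` E) then ln (real (card (q ` E))) / real n else 0)"
    using E(3) card_image[OF inj] by simp
  also have "\<dots> \<le> rational_growth n e \<omega>"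
    unfolding rational_growth_def using q(1) E(1) by (intro SUP_upper) auto
  finally show ?thesis .
qed

text \<open>The rational substitute lies below the true growth at its own scale and above the growth
  at any larger scale, so passing from scale index \<open>j\<close> to \<open>Suc j\<close> makes
  the two suprema equal.\<close>

lemma entropy_limit_measurable: "entropy_limit \<in> borel_measurable M"
proof -
  define K where "K \<omega> = (SUP j. limsup (\<lambda>n. rational_growth n (1 / real (Suc j)) \<omega>))" for \<omega>
  have [measurable]: "rational_growth n e \<in> borel_measurable M" for n e
    by (rule rational_growth_measurable)
  have "entropy_limit \<omega> = K \<omega>" if \<omega>: "\<omega> \<in> space M" for \<omega>
  proof (rule antisym)
    show "entropy_limit \<omega> \<le> K \<omega>"
      unfolding entropy_limit_def K_def
    proof (rule SUP_mono)
      fix j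
      have "1 / real (Suc (Suc j)) < 1 / real (Suc j)" by (simp add: field_simps)
      then have "entropy_at_scale \<sigma> f (1 / real (Suc j)) \<omega>
          \<le> limsup (\<lambda>n. rational_growth n (1 / real (Suc (Suc j))) \<omega>)"
        unfolding entropy_at_scale_def
        by (intro Limsup_mono eventually_mono[OF eventually_gt_at_top[of 0]] rational_growth_ge \<omega>)
          auto
      then show "\<exists>i\<in>UNIV. entropy_at_scale \<sigma> f (1 / real (Suc j)) \<omega>
          \<le> limsup (\<lambda>n. rational_growth n (1 / real (Suc i)) \<omega>)" by blast
    qed
    show "K \<omega> \<le> entropy_limit \<omega>"
      unfolding entropy_limit_def K_def entropy_at_scale_def
      by (intro SUP_mono' Limsup_mono eventually_mono[OF eventually_gt_at_top[of 0]]
          rational_growth_le \<omega>) auto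
  qed
  moreover have "K \<in> borel_measurable M" unfolding K_def[abs_def] by measurable
  ultimately show ?thesis by (subst measurable_cong[of M _ K]) auto
qed

text \<open>Sub-invariance makes the limit a constant \<open>c\<close>, and any other constant
  fitting the definite description equals \<open>c\<close> almost surely, hence outright.\<close>

lemma random_top_entropy_AE:
  "AE \<omega> in M. random_top_entropy M \<sigma> f = entropy_limit \<omega>"
proof -
  obtain c where c: "AE \<omega> in M. entropy_limit \<omega> = c"
    using AE_const_if_sub_invariant[OF entropy_limit_measurable entropy_limit_base_le] by blast
  have lim: "AE \<omega> in M. ((\<lambda>e. entropy_at_scale \<sigma> f e \<omega>) \<longlongrightarrow> c) (at_right 0)"
    using c AE_space
    by eventually_elim (use entropy_at_scale_tendsto_limit in blast)
  have "random_top_entropy M \<sigma> f = c"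
    unfolding random_top_entropy_def
  proof (rule the_equality)
    show "AE \<omega> in M. ((\<lambda>e. entropy_at_scale \<sigma> f e \<omega>) \<longlongrightarrow> c) (at_right 0)" by (rule lim)
  next
    fix h assume "AE \<omega> in M. ((\<lambda>e. entropy_at_scale \<sigma> f e \<omega>) \<longlongrightarrow> h) (at_right 0)"
    with lim have "AE \<omega> in M. h = c"
      by eventually_elim (rule tendsto_unique[OF trivial_limit_at_right_real])
    then show "h = c" by simp
  qed
  with c show ?thesis by (auto elim: eventually_mono)
qed

end

section \<open>Positive entropy\<close>

context integrable_degree_one_cocycle
begin

lemma cocycle_upper_envelope_eq:
  "\<omega> \<in> space M \<Longrightarrow> cocycle \<sigma> (\<lambda>\<omega>. upper_envelope (G \<omega>)) n \<omega> = upper_envelope (cocycle \<sigma> G n \<omega>)"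
  by (intro cocycle_upper_envelope End1_iterate)

lemma cocycle_lower_envelope_eq:
  assumes "\<omega> \<in> space M"
  shows "cocycle \<sigma> (\<lambda>\<omega>. reflect (upper_envelope (reflect (G \<omega>)))) n \<omega> =
    reflect (upper_envelope (reflect (cocycle \<sigma> G n \<omega>)))"
proof -
  interpret R: integrable_degree_one_cocycle M \<sigma> "\<lambda>\<omega>. reflect (G \<omega>)" b
    by (rule reflect_cocycle)
  show ?thesis
    unfolding cocycle_reflect[of \<sigma> "\<lambda>\<omega>. upper_envelope (reflect (G \<omega>))"]
    by (simp add: R.cocycle_upper_envelope_eq assms cocycle_reflect)
qed

lemma upper_envelope_monotone_cocycle:
  "monotone_degree_one_cocycle M \<sigma> (\<lambda>\<omega>. upper_envelope (G \<omega>)) b"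
proof -
  interpret U: integrable_degree_one_cocycle M \<sigma> "\<lambda>\<omega>. upper_envelope (G \<omega>)" b
    by (rule upper_envelope_cocycle)
  show ?thesis
    by standard (auto intro!: monoI upper_envelope_mono End1)
qed

lemma lower_envelope_monotone_cocycle:
  "monotone_degree_one_cocycle M \<sigma> (\<lambda>\<omega>. reflect (upper_envelope (reflect (G \<omega>)))) b"
proof -
  interpret R: integrable_degree_one_cocycle M \<sigma> "\<lambda>\<omega>. reflect (G \<omega>)" b
    by (rule reflect_cocycle)
  interpret RU: integrable_degree_one_cocycle M \<sigma> "\<lambda>\<omega>. upper_envelope (reflect (G \<omega>))" b
    by (rule R.upper_envelope_cocycle)
  interpret L: integrable_degree_one_cocycle M \<sigma> "\<lambda>\<omega>. reflect (upper_envelope (reflect (G \<omega>)))" b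
    by (rule RU.reflect_cocycle)
  show ?thesis
  proof
    fix \<omega> assume "\<omega> \<in> space M"
    from upper_envelope_mono[OF R.End1[OF this]]
    show "mono (reflect (upper_envelope (reflect (G \<omega>))))"
      by (intro monoI) (simp add: reflect_def[of "upper_envelope _"])
  qed
qed

section \<open>Measurability and integrability of the two competing rates\<close>

lemma strong_shear_measurable: "{\<omega> \<in> space M. strong_shear N \<omega>} \<in> sets M"
proof -
  interpret U: monotone_degree_one_cocycle M \<sigma> "\<lambda>\<omega>. upper_envelope (G \<omega>)" b
    by (rule upper_envelope_monotone_cocycle)
  interpret L: monotone_degree_one_cocycle M \<sigma> "\<lambda>\<omega>. reflect (upper_envelope (reflect (G \<omega>)))" b
    by (rule lower_envelope_monotone_cocycle)
  have "{\<omega> \<in> space M. strong_shear N \<omega>} = {\<omega> \<in> space M.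
      7 \<le> cocycle \<sigma> (\<lambda>\<omega>. upper_envelope (G \<omega>)) N \<omega> 0
        - cocycle \<sigma> (\<lambda>\<omega>. reflect (upper_envelope (reflect (G \<omega>)))) N \<omega> 0}"
    by (auto simp: strong_shear_def cocycle_upper_envelope_eq cocycle_lower_envelope_eq)
  also have "\<dots> \<in> sets M" by measurable
  finally show ?thesis .
qed

text \<open>Rational pairs suffice: the strict inequality \<open>\<bar>x - y\<bar> < e\<close>
  leaves room to move both points, and the conclusion is closed under limits.\<close>

lemma almost_isometric_measurable: "{\<omega> \<in> space M. almost_isometric e (G \<omega>)} \<in> sets M"
proof -
  have "almost_isometric e (G \<omega>)"
    if \<omega>: "\<omega> \<in> space M" and rat: "\<forall>x\<in>\<rat>. \<forall>y\<in>\<rat>. \<bar>x - y\<bar> < e \<longrightarrow> \<bar>G \<omega> x - G \<omega> y\<bar> \<le> 1 / 2" for \<omega>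
    unfolding almost_isometric_def
  proof (intro allI impI, rule field_le_epsilon)
    fix x y h :: real assume xy: "\<bar>x - y\<bar> < e" and h: "0 < h"
    obtain d where d: "0 < d" "\<And>x y. \<bar>x - y\<bar> < d \<Longrightarrow> \<bar>G \<omega> x - G \<omega> y\<bar> < h / 2"
      using End1_real_uniformly_continuous[OF End1[OF \<omega>] half_gt_zero[OF h]] by blast
    define t where "t = \<bar>x - y\<bar>"
    have t: "x - y \<le> t" "y - x \<le> t" "t < e" using xy by (simp_all add: t_def)
    \<comment> \<open>Moving both points by less than \<open>s\<close> keeps their distance below
      \<open>e\<close> and, as \<open>s \<le> d\<close>, changes each image by less than
      \<open>h / 2\<close>.\<close>
    define s where "s = min d ((e - t) / 2)"
    have s: "0 < s" using d(1) t(3) by (simp add: s_def)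
    obtain x' where x': "x' \<in> \<rat>" "x < x'" "x' < x + s"
      using Rats_dense_in_real[of x "x + s"] s by auto
    obtain y' where y': "y' \<in> \<rat>" "y < y'" "y' < y + s"
      using Rats_dense_in_real[of y "y + s"] s by auto
    have s_le: "s \<le> d" "s \<le> (e - t) / 2"
      unfolding s_def by (rule min.cobounded1, rule min.cobounded2)
    have "2 * s \<le> e - t" using s_le(2) by simp
    then have "x' - y' < e" "y' - x' < e" using x' y' t by linarith+
    then have "\<bar>x' - y'\<bar> < e" by simp
    then have "\<bar>G \<omega> x' - G \<omega> y'\<bar> \<le> 1 / 2" using rat x'(1) y'(1) by blast
    moreover have near: "\<bar>x - x'\<bar> < d" "\<bar>y - y'\<bar> < d" using x' y' s_le by auto
    note d(2)[OF near(1)] d(2)[OF near(2)]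
    ultimately show "\<bar>G \<omega> x - G \<omega> y\<bar> \<le> 1 / 2 + h" by linarith
  qed
  then have "{\<omega> \<in> space M. almost_isometric e (G \<omega>)} = {\<omega> \<in> space M.
      \<forall>x\<in>\<rat>. \<forall>y\<in>\<rat>. \<bar>x - y\<bar> < e \<longrightarrow> \<bar>G \<omega> x - G \<omega> y\<bar> \<le> 1 / 2}"
    by (auto simp: almost_isometric_def)
  also have "\<dots> \<in> sets M"
  proof -
    note [measurable] = G_measurable
    have [simp]: "countable (\<rat> :: real set)" by (rule countable_rat)
    show ?thesis by measurable
  qed
  finally show ?thesis .
qed

text \<open>The upper bound is an integrable majorant that does not depend on the scale.\<close>

lemma ln_jump_count_bounds:
  assumes "\<omega> \<in> space M"
  shows "0 \<le> ln (jump_count e \<omega>)" "ln (jump_count e \<omega>) \<le> 4 * b \<omega> + 3"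
proof -
  show "0 \<le> ln (jump_count e \<omega>)" using jump_count_ge_1[OF assms] by simp
  have "ln (jump_count e \<omega>) \<le> jump_count e \<omega> - 1"
    using jump_count_ge_1[OF assms, of e] by (intro ln_le_minus_one) linarith
  also have "\<dots> \<le> 4 * b \<omega> + 3" using b_nonneg[OF assms] by (simp add: jump_count_def)
  finally show "ln (jump_count e \<omega>) \<le> 4 * b \<omega> + 3" .
qed

lemma ln_jump_count_measurable: "(\<lambda>\<omega>. ln (jump_count e \<omega>)) \<in> borel_measurable M"
proof -
  have [measurable]: "{\<omega> \<in> space M. almost_isometric e (G \<omega>)} \<in> sets M"
    by (rule almost_isometric_measurable)
  have [measurable]: "b \<in> borel_measurable M" using b_integrable by blast
  show ?thesis unfolding jump_count_def by measurable
qed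

lemma bound_integrable: "integrable M (\<lambda>\<omega>. 4 * b \<omega> + 3)"
  using b_integrable by auto

lemma ln_jump_count_integrable: "integrable M (\<lambda>\<omega>. ln (jump_count e \<omega>))"
proof (rule Bochner_Integration.integrable_bound[OF bound_integrable ln_jump_count_measurable])
  show "AE \<omega> in M. norm (ln (jump_count e \<omega>)) \<le> norm (4 * b \<omega> + 3)"
  proof (rule AE_I2)
    fix \<omega> assume "\<omega> \<in> space M"
    from ln_jump_count_bounds[OF this, of e]
    show "norm (ln (jump_count e \<omega>)) \<le> norm (4 * b \<omega> + 3)" by simp
  qed
qed

text \<open>For a fixed \<omega>, uniform continuity of \<open>G \<omega>\<close> makes the
  integrand vanish at all small scales; domination does the rest.\<close>

lemma integral_ln_jump_count_tendsto_0:
  "(\<lambda>j. \<integral>\<omega>. ln (jump_count (1 / real (Suc j)) \<omega>) \<partial>M) \<longlonglongrightarrow> 0"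
proof -
  have "(\<lambda>j. \<integral>\<omega>. ln (jump_count (1 / real (Suc j)) \<omega>) \<partial>M) \<longlonglongrightarrow> (\<integral>\<omega>. 0 \<partial>M)"
  proof (rule integral_dominated_convergence[OF _ ln_jump_count_measurable bound_integrable])
    show "AE \<omega> in M. (\<lambda>j. ln (jump_count (1 / real (Suc j)) \<omega>)) \<longlonglongrightarrow> 0"
    proof (rule AE_I2)
      fix \<omega> assume \<omega>: "\<omega> \<in> space M"
      obtain d where d: "0 < d" "\<And>x y. \<bar>x - y\<bar> < d \<Longrightarrow> \<bar>G \<omega> x - G \<omega> y\<bar> < 1 / 2"
        using End1_real_uniformly_continuous[OF End1[OF \<omega>], of "1 / 2"] by auto
      obtain k where k: "1 / real (Suc k) < d" using nat_approx_posE[OF d(1)] .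
      have "ln (jump_count (1 / real (Suc j)) \<omega>) = 0" if "k \<le> j" for j
      proof -
        have "1 / real (Suc j) \<le> 1 / real (Suc k)"
          using that by (intro divide_left_mono) auto
        with k have "1 / real (Suc j) < d" by linarith
        then have "almost_isometric (1 / real (Suc j)) (G \<omega>)"
          using d(2) unfolding almost_isometric_def by (meson less_imp_le less_trans)
        then show ?thesis by (simp add: jump_count_def)
      qed
      then show "(\<lambda>j. ln (jump_count (1 / real (Suc j)) \<omega>)) \<longlonglongrightarrow> 0"
        by (intro tendsto_eventually) (auto simp: eventually_sequentially)
    qed
    show "AE \<omega> in M. norm (ln (jump_count (1 / real (Suc j)) \<omega>)) \<le> 4 * b \<omega> + 3" for j
    proof (rule AE_I2)
      fix \<omega> assume "\<omega> \<in> space M"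
      from ln_jump_count_bounds[OF this]
      show "norm (ln (jump_count (1 / real (Suc j)) \<omega>)) \<le> 4 * b \<omega> + 3" by simp
    qed
  qed simp
  then show ?thesis by simp
qed

end

section \<open>The entropy estimate\<close>

context circle_cocycle_with_lift
begin

text \<open>The constructed lifts number at least \<open>2 ^ g\<close>, where \<open>g + 1\<close>
  is at least the number of shear times divided by \<open>N\<close>; the projection costs the factor
  5 times the product of jump counts. After taking logarithms, Birkhoff's theorem evaluates both
  rates.\<close>

lemma entropy_at_scale_ge:
  assumes N: "0 < N" and e: "0 < e" "e \<le> 1 / 4"
  shows "AE \<omega> in M. ereal (prob {\<omega> \<in> space M. strong_shear N \<omega>} / real N * ln 2
      - (\<integral>\<omega>. ln (jump_count e \<omega>) \<partial>M)) \<le> entropy_at_scale \<sigma> f e \<omega>"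
proof -
  define A where "A = {\<omega> \<in> space M. strong_shear N \<omega>}"
  have A: "A \<in> sets M" unfolding A_def by (rule strong_shear_measurable)
  have "integrable M (indicator A :: _ \<Rightarrow> real)"
    using A by (intro integrable_real_indicator) (auto simp: less_top[symmetric])
  note AE_birkhoff[OF this] AE_birkhoff[OF ln_jump_count_integrable[of e]]
  then show ?thesis
    using AE_space
  proof eventually_elim
    case (elim \<omega>)
    note \<omega> = elim(3)
    define C where "C n = (\<Sum>k<n. indicator A ((\<sigma> ^^ k) \<omega>) :: real)" for n
    define S where "S n = (\<Sum>k<n. ln (jump_count e ((\<sigma> ^^ k) \<omega>)))" for n
    define I where "I = (\<integral>\<omega>. ln (jump_count e \<omega>) \<partial>M)"
    have C_card: "C n = real (card {l. l < n \<and> strong_shear N ((\<sigma> ^^ l) \<omega>)})" for n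
    proof -
      have "C n = (\<Sum>k<n. if strong_shear N ((\<sigma> ^^ k) \<omega>) then 1 else 0)"
        unfolding C_def by (intro sum.cong) (auto simp: A_def base_iterate_space[OF \<omega>])
      also have "\<dots> = real (card {l. l < n \<and> strong_shear N ((\<sigma> ^^ l) \<omega>)})"
        by (simp add: sum.If_cases Int_def)
      finally show ?thesis .
    qed
    \<comment> \<open>The -1 comes from \<open>g + 1\<close> in the count of shear times,
      \<open>ln 5\<close> from the initial offsets, and \<open>Suc n\<close> from including time
      n.\<close>
    define u where "u n = ((C n / real N - 1) * ln 2 - ln 5 - S n) / real (Suc n)" for n
    have "ereal (prob A / real N * ln 2 - I) \<le>
        limsup (\<lambda>n. ereal (ln (real (max_separated \<sigma> f n e \<omega>)) / real n))"
    proof (rule LIMSEQ_imp_limsup_ge_shifted[of u])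
      have "(\<lambda>n. C n / real n) \<longlonglongrightarrow> prob A" "(\<lambda>n. S n / real n) \<longlonglongrightarrow> I"
        using elim(1,2) A by (simp_all add: C_def S_def I_def)
      moreover have "(\<lambda>n. real n / real (Suc n)) \<longlonglongrightarrow> 1"
        "(\<lambda>n. (ln 2 + ln 5) / real (Suc n)) \<longlonglongrightarrow> 0" by real_asymp+
      ultimately have "(\<lambda>n. (C n / real n * (real n / real (Suc n))) / real N * ln 2
          - (ln 2 + ln 5) / real (Suc n) - S n / real n * (real n / real (Suc n)))
          \<longlonglongrightarrow> prob A * 1 / real N * ln 2 - 0 - I * 1"
        using N by (intro tendsto_intros) auto
      moreover have "(C n / real n * (real n / real (Suc n))) / real N * ln 2
          - (ln 2 + ln 5) / real (Suc n) - S n / real n * (real n / real (Suc n)) = u n" for n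
      proof (cases "n = 0")
        case True
        then show ?thesis by (simp add: u_def C_def S_def)
      next
        case False
        then have "C n / real n * (real n / real (Suc n)) = C n / real (Suc n)"
          "S n / real n * (real n / real (Suc n)) = S n / real (Suc n)" by simp_all
        then show ?thesis
          by (simp add: u_def diff_divide_distrib add_divide_distrib left_diff_distrib
              del: of_nat_Suc)
      qed
      ultimately show "u \<longlonglongrightarrow> prob A / real N * ln 2 - I" by simp
    next
      fix n
      define s where "s = real (max_separated \<sigma> f (Suc n) e \<omega>)"
      have s: "1 \<le> s" using max_separated_pos[OF \<omega> e(1), of "Suc n"] by (simp add: s_def)
      obtain P g where P: "finite P" "P \<subseteq> {0..0 + 2}" "2 ^ g \<le> card P"
        "card {l. l < n \<and> strong_shear N ((\<sigma> ^^ l) \<omega>)} \<le> (g + 1) * N"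
        "\<And>x y. x \<in> P \<Longrightarrow> y \<in> P \<Longrightarrow> x \<noteq> y \<Longrightarrow>
          \<exists>k\<le>n. 1 \<le> \<bar>cocycle \<sigma> G k \<omega> x - cocycle \<sigma> G k \<omega> y\<bar>"
        using exists_separated_lifts[OF \<omega> N, of 0 n] by blast
      have J_pos: "0 < jump_count e ((\<sigma> ^^ k) \<omega>)" for k
        using jump_count_ge_1[OF base_iterate_space[OF \<omega>], of e k] by linarith
      let ?J = "\<Prod>k<n. jump_count e ((\<sigma> ^^ k) \<omega>)"
      have "2 ^ g \<le> real (card P)" using P(3) by (metis of_nat_le_iff of_nat_numeral of_nat_power)
      also have "\<dots> \<le> s * (5 * ?J)"
        unfolding s_def by (rule card_separated_lifts_le[OF \<omega> e P(1,2,5)])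
      finally have "ln (2 ^ g) \<le> ln (s * (5 * ?J))"
        by (rule ln_mono[rotated 2]) (use s J_pos in \<open>auto intro!: mult_pos_pos prod_pos\<close>)
      also have "\<dots> = ln s + (ln 5 + ln ?J)"
      proof -
        have "ln (s * (5 * y)) = ln s + (ln 5 + ln y)" if "0 < y" for y
          using s that by (simp add: ln_mult)
        moreover have "0 < ?J" using J_pos by (intro prod_pos) blast
        ultimately show ?thesis by blast
      qed
      also have "ln ?J = S n"
        unfolding S_def by (intro ln_prod) (use J_pos in \<open>simp_all add: less_imp_neq[symmetric]\<close>)
      finally have g: "real g * ln 2 \<le> ln s + (ln 5 + S n)" by (simp add: ln_realpow)
      have "C n \<le> (real g + 1) * real N"
        using P(4) unfolding C_card by (metis of_nat_1 of_nat_add of_nat_le_iff of_nat_mult)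
      then have "C n / real N - 1 \<le> real g" using N by (simp add: field_simps)
      then have "(C n / real N - 1) * ln 2 \<le> real g * ln 2" by (rule mult_right_mono) simp
      with g have "(C n / real N - 1) * ln 2 - ln 5 - S n \<le> ln s" by linarith
      then show "u n \<le> ln (real (max_separated \<sigma> f (Suc n) e \<omega>)) / real (Suc n)"
        unfolding u_def s_def by (intro divide_right_mono) auto
    qed
    then show ?case by (simp add: entropy_at_scale_def A_def I_def)
  qed
qed

lemma random_top_entropy_pos_if_shear:
  assumes N: "0 < N" and pos: "0 < prob {\<omega> \<in> space M. strong_shear N \<omega>}"
  shows "0 < random_top_entropy M \<sigma> f"
proof -
  define c where "c = prob {\<omega> \<in> space M. strong_shear N \<omega>} / real N * ln 2"
  have c: "0 < c" using N pos by (simp add: c_def)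
  have "\<forall>\<^sub>F j in sequentially. (\<integral>\<omega>. ln (jump_count (1 / real (Suc j)) \<omega>) \<partial>M) < c"
    using order_tendstoD(2)[OF integral_ln_jump_count_tendsto_0 c] .
  \<comment> \<open>The condition \<open>3 \<le> j\<close> ensures that the scale is at most
    1/4.\<close>
  then have "\<forall>\<^sub>F j in sequentially. (\<integral>\<omega>. ln (jump_count (1 / real (Suc j)) \<omega>) \<partial>M) < c \<and> 3 \<le> j"
    by (intro eventually_conj eventually_ge_at_top)
  then obtain j where j: "(\<integral>\<omega>. ln (jump_count (1 / real (Suc j)) \<omega>) \<partial>M) < c" "3 \<le> j"
    by (auto dest!: eventually_happens)
  define e where "e = 1 / real (Suc j)"
  have e: "0 < e" "e \<le> 1 / 4" using j(2) by (auto simp: e_def field_simps)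
  have "AE \<omega> in M. 0 < random_top_entropy M \<sigma> f"
    using entropy_at_scale_ge[OF N e] random_top_entropy_AE AE_space
  proof eventually_elim
    case (elim \<omega>)
    have "0 < ereal (c - (\<integral>\<omega>. ln (jump_count e \<omega>) \<partial>M))" using j(1) by (simp add: e_def)
    also have "\<dots> \<le> entropy_at_scale \<sigma> f e \<omega>" using elim(1) by (simp add: c_def)
    also have "\<dots> \<le> entropy_limit \<omega>" by (rule entropy_at_scale_le_limit[OF elim(3) e(1)])
    finally show ?case using elim(2) by simp
  qed
  then show ?thesis by simp
qed

end

text \<open>Without shear of positive probability, the upper and lower cocycles at 0 almost surely
  differ by at most 7 at every positive time. Dividing by n gives the reverse inequality between the
  rotation numbers.\<close>

lemma (in integrable_degree_one_cocycle) exists_strong_shear: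
  assumes "rotation_number M \<sigma> (lower_map G) < rotation_number M \<sigma> (upper_map G)"
  shows "\<exists>N>0. 0 < prob {\<omega> \<in> space M. strong_shear N \<omega>}"
proof (rule ccontr)
  assume "\<not> ?thesis"
  then have zero: "prob {\<omega> \<in> space M. strong_shear N \<omega>} = 0" if "0 < N" for N
    using that by (meson measure_nonneg not_less order_antisym)
  have upper: "upper_map G = (\<lambda>\<omega>. upper_envelope (G \<omega>))"
    by (intro ext) (simp add: upper_map_eq_upper_envelope)
  have lower: "lower_map G = (\<lambda>\<omega>. reflect (upper_envelope (reflect (G \<omega>))))"
    by (intro ext) (simp add: lower_map_eq_reflect_upper_envelope)
  interpret U: monotone_degree_one_cocycle M \<sigma> "\<lambda>\<omega>. upper_envelope (G \<omega>)" b
    by (rule upper_envelope_monotone_cocycle)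
  interpret L: monotone_degree_one_cocycle M \<sigma> "\<lambda>\<omega>. reflect (upper_envelope (reflect (G \<omega>)))" b
    by (rule lower_envelope_monotone_cocycle)
  note rot_U = U.rotation_function[folded upper] and rot_L = L.rotation_function[folded lower]
  have "AE \<omega> in M. \<forall>N. \<not> strong_shear (Suc N) \<omega>"
  proof (subst AE_all_countable, rule allI)
    fix N
    show "AE \<omega> in M. \<not> strong_shear (Suc N) \<omega>"
      using zero[of "Suc N"] prob_eq_0[OF strong_shear_measurable[of "Suc N"]] by auto
  qed
  then have "AE \<omega> in M. rotation_function M \<sigma> (upper_map G) \<omega> \<le> rotation_function M \<sigma> (lower_map G) \<omega>"
    using rot_U(2)[of 0] rot_L(2)[of 0] AE_space
  proof eventually_elim
    case (elim \<omega>)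
    have "cocycle \<sigma> (upper_map G) n \<omega> 0 - cocycle \<sigma> (lower_map G) n \<omega> 0 \<le> 7" if "0 < n" for n
    proof -
      have "\<not> strong_shear n \<omega>" using elim(1) that by (metis Suc_pred)
      then show ?thesis
        using cocycle_upper_envelope_eq[OF elim(4)] cocycle_lower_envelope_eq[OF elim(4)]
        by (simp add: strong_shear_def upper lower)
    qed
    then have "\<forall>\<^sub>F n in sequentially. (cocycle \<sigma> (upper_map G) n \<omega> 0 - 0) / real n
        \<le> (cocycle \<sigma> (lower_map G) n \<omega> 0 - 0) / real n + 7 / real n"
      by (intro eventually_mono[OF eventually_gt_at_top[of 0]])
        (auto simp: add_divide_distrib[symmetric] diff_le_eq add.commute intro!: divide_right_mono)
    moreover have "(\<lambda>n. (cocycle \<sigma> (lower_map G) n \<omega> 0 - 0) / real n + 7 / real n)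
        \<longlonglongrightarrow> rotation_function M \<sigma> (lower_map G) \<omega> + 0"
      using elim(3) by (intro tendsto_add lim_const_over_n)
    ultimately show ?case
      using tendsto_le[OF sequentially_bot _ elim(2)] by simp
  qed
  then have "rotation_number M \<sigma> (upper_map G) \<le> rotation_number M \<sigma> (lower_map G)"
    unfolding rotation_number_def using rot_U(1) rot_L(1) by (intro integral_mono_AE)
  with assms show False by simp
qed

section \<open>From the given random lift to the abstract cocycle\<close>

text \<open>Evaluation at a point is 1-Lipschitz for \<open>sup_dist\<close>, so preimages of open
  sets are among the generators of the \<sigma>-algebra.\<close>

lemma measurable_uniform_borel_eval:
  "(\<lambda>F. F x) \<in> measurable (uniform_borel End1_real) borel"
proof (rule borel_measurableI)
  fix V :: "real set" assume V: "open V"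
  let ?O = "{U. U \<subseteq> End1_real \<and> (\<forall>f\<in>U. \<exists>e>0. \<forall>g\<in>End1_real. sup_dist f g < e \<longrightarrow> g \<in> U)}"
  have sub: "?O \<subseteq> Pow End1_real" by blast
  have space: "space (uniform_borel End1_real) = End1_real"
    unfolding uniform_borel_def by (rule space_measure_of[OF sub])
  have "(\<lambda>F. F x) -` V \<inter> End1_real \<in> ?O"
  proof (intro CollectI conjI ballI)
    fix F assume F: "F \<in> (\<lambda>F. F x) -` V \<inter> End1_real"
    then obtain e where e: "0 < e" "\<And>y. dist y (F x) < e \<Longrightarrow> y \<in> V"
      using V unfolding open_dist by blast
    have "H \<in> (\<lambda>F. F x) -` V \<inter> End1_real" if H: "H \<in> End1_real" "sup_dist F H < e" for H
    proof -
      have "\<bar>F x - H x\<bar> < e" using dist_le_sup_dist_End1_real[of F H x] F H by simp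
      then have "H x \<in> V" by (intro e(2)) (simp add: dist_real_def)
      then show ?thesis using H by simp
    qed
    then show "\<exists>e>0. \<forall>H\<in>End1_real. sup_dist F H < e \<longrightarrow> H \<in> (\<lambda>F. F x) -` V \<inter> End1_real"
      using e(1) by blast
  qed blast
  then show "(\<lambda>F. F x) -` V \<inter> space (uniform_borel End1_real) \<in> sets (uniform_borel End1_real)"
    unfolding space unfolding uniform_borel_def by (rule in_measure_of[OF sub])
qed

theorem theorem2p3:
  fixes M :: "'w measure"
    and \<sigma> :: "'w \<Rightarrow> 'w"
    and f :: "'w \<Rightarrow> circle \<Rightarrow> circle"
    and F :: "'w \<Rightarrow> real \<Rightarrow> real"
  assumes "ergodic_system M \<sigma>"
    and "random_circle_endomorphism M f"
    and "random_lift M f F"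
    and "F \<in> integrable_lifts M"
    and "rotation_number M \<sigma> (lower_map F) < rotation_number M \<sigma> (upper_map F)"
  shows "0 < random_top_entropy M \<sigma> f"
proof -
  have F: "F \<in> measurable M (uniform_borel End1_real)"
    using assms(4) by (simp add: integrable_lifts_def)
  have End1: "F \<omega> \<in> End1_real" if "\<omega> \<in> space M" for \<omega>
    using measurable_space[OF F that]
    by (simp add: uniform_borel_def space_measure_of_conv)
  interpret prob_space M using assms(1) by (simp add: ergodic_system_def)
  interpret circle_cocycle_with_lift M \<sigma> F "\<lambda>\<omega>. sup_dist (F \<omega>) id" f
  proof
    show "\<sigma> \<in> measurable M M" "distr M M \<sigma> = M"
      "\<And>A. A \<in> events \<Longrightarrow> \<sigma> -` A \<inter> space M = A \<Longrightarrow> prob A = 0 \<or> prob A = 1"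
      using assms(1) by (simp_all add: ergodic_system_def)
    show "\<And>\<omega>. \<omega> \<in> space M \<Longrightarrow> F \<omega> \<in> End1_real" by (rule End1)
    show "(\<lambda>\<omega>. F \<omega> x) \<in> borel_measurable M" for x
      by (rule measurable_compose[OF F measurable_uniform_borel_eval])
    show "integrable M (\<lambda>\<omega>. sup_dist (F \<omega>) id)"
      using assms(4) by (simp add: integrable_lifts_def)
    show "\<bar>F \<omega> x - x\<bar> \<le> sup_dist (F \<omega>) id" if "\<omega> \<in> space M" for \<omega> x
      using dist_le_sup_dist_End1_real[OF End1[OF that] id_End1_real, of x] by simp
    show "f \<omega> (proj x) = proj (F \<omega> x)" if "\<omega> \<in> space M" for \<omega> x
    proof -
      have "proj \<circ> F \<omega> = f \<omega> \<circ> proj" using assms(3) that by (simp add: random_lift_def)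
      from fun_cong[OF this, of x] show ?thesis by simp
    qed
  qed
  show ?thesis
    using exists_strong_shear[OF assms(5)] random_top_entropy_pos_if_shear by blast
qed

end
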